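(* Let $G$ be an abelian $\ell$-group, let $P\subseteq\mathrm{Spec}(G)$ with $\bigcap P=\{0\}$, and let $\widehat{G}+B$ be the $\ell$-group obtained from $G$ and $P$ by the $G+B$ construction. The following statements are equivalent. (1) $\widehat{G}+B\in(\mathrm{M})$. (2) $P\subseteq\mathrm{Max}(G)$ and $P$ is patch dense in $\mathrm{Spec}(G)$. (3) $G\in(\mathrm{Y})$ and $P$ is a patch dense subset of $\mathrm{Max}(G)$.
   Context: For an $\ell$-group $K$ and $a\in K$, $K(a)=\{b\in K:|b|\le n|a|\text{ for some }n\in\mathbb{N}\}$ is the principal convex $\ell$-subgroup generated by $a$; for $S\subseteq K$, $S^\perp=\{h\in K:|h|\wedge|s|=0\text{ for all }s\in S\}$. $K\in(\mathrm{M})$ means that every convex $\ell$-subgroup $H$ of $K$ satisfies $a^{\perp\perp}\subseteq H$ for all $a\in H$; equivalently $K(a)=a^{\perp\perp}$ for all $a\in K$. $\mathrm{Max}(K)$ is the set of maximal (proper) convex $\ell$-subgroups, and $K\in(\mathrm{Y})$ means that for every $a\in K$, $K(a)$ is an intersection of members of $\mathrm{Max}(K)$ (the empty intersection being $K$). $\mathrm{Spec}(K)$ is the set of proper prime subgroups (proper convex $\ell$-subgroups $p$ such that $a\wedge b=0$ implies $a\in p$ or $b\in p$); $\mathrm{Max}(K)\subseteq\mathrm{Spec}(K)$. The patch topology on $\mathrm{Spec}(G)$ has base the sets $\{p\in\mathrm{Spec}(G):a\notin p,\ b\in p\}$, $a,b\in G$; $\mathrm{Max}(G)$ carries the subspace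 topology; patch dense means dense in the patch topology. The $G+B$ construction: given an abelian $\ell$-group $G$ and $P\subseteq\mathrm{Spec}(G)$ with $\bigcap P=\{0\}$, for each $(p,n)\in P\times\mathbb{N}$ let $G(p,n)$ be a copy of the totally ordered group $G/p$, and let $G[P,\mathbb{N}]=\prod\{G(p,n):(p,n)\in P\times\mathbb{N}\}$. For $g\in G$ let $\widehat{g}\in G[P,\mathbb{N}]$ be given by $\widehat{g}(p,n)=g+p$; $g\mapsto\widehat{g}$ is an embedding with image $\widehat{G}$. Let $B=\bigoplus\{G(p,n):(p,n)\in P\times\mathbb{N}\}\subseteq G[P,\mathbb{N}]$ be the direct sum (elements of finite support). Then $\widehat{G}+B$ is the $\ell$-subgroup of $G[P,\mathbb{N}]$ generated by $\widehat{G}$ and $B$; its elements are exactly the sums $\widehat{g}+b$ with $g\in G$, $b\in B$. *)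

theory Defs
  imports "HOL-Analysis.Analysis" "HOL-Algebra.Product_Groups" "HOL-Algebra.Lattice"
begin

section \<open>Abelian lattice-ordered groups\<close>

text \<open>
  Lattice-ordered groups are carrier-based, so that quotients \<open>G/p\<close> (with \<open>p\<close> ranging over a
  set of primes), their products, and subgroups of these are again objects of the same kind.
  As usual in HOL-Algebra, the group operation is written multiplicatively: the \<open>g + h\<close>, \<open>-g\<close>,
  \<open>0\<close>, \<open>n g\<close> of the literature are \<open>g \<otimes> h\<close>, \<open>inv g\<close>, \<open>\<one>\<close>, \<open>g [^] n\<close>.
\<close>

record 'a lgroup = "'a monoid" +
  lle :: "'a \<Rightarrow> 'a \<Rightarrow> bool" (infixl "\<preceq>\<index>" 50)

definition ord_of :: "('a, 'b) lgroup_scheme \<Rightarrow> 'a gorder" where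
  "ord_of K = \<lparr>carrier = carrier K, eq = (=), le = lle K\<rparr>"

locale abelian_lgroup = comm_group K + order: Lattice.lattice "ord_of K" for K (structure) +
  assumes mult_mono:
    "\<lbrakk>x \<in> carrier K; y \<in> carrier K; z \<in> carrier K; x \<preceq> y\<rbrakk> \<Longrightarrow> x \<otimes> z \<preceq> y \<otimes> z"

abbreviation lmeet :: "('a, 'b) lgroup_scheme \<Rightarrow> 'a \<Rightarrow> 'a \<Rightarrow> 'a" (infixl "\<^bold>\<and>\<index>" 70) where
  "x \<^bold>\<and>\<^bsub>K\<^esub> y \<equiv> x \<sqinter>\<^bsub>ord_of K\<^esub> y"

abbreviation ljoin :: "('a, 'b) lgroup_scheme \<Rightarrow> 'a \<Rightarrow> 'a \<Rightarrow> 'a" (infixl "\<^bold>\<or>\<index>" 65) where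
  "x \<^bold>\<or>\<^bsub>K\<^esub> y \<equiv> x \<squnion>\<^bsub>ord_of K\<^esub> y"

definition labs :: "('a, 'b) lgroup_scheme \<Rightarrow> 'a \<Rightarrow> 'a" where
  "labs K a = a \<^bold>\<or>\<^bsub>K\<^esub> inv\<^bsub>K\<^esub> a"

definition l_subgroup :: "'a set \<Rightarrow> ('a, 'b) lgroup_scheme \<Rightarrow> bool" where
  "l_subgroup H K \<longleftrightarrow> subgroup H K \<and>
     (\<forall>x\<in>H. \<forall>y\<in>H. x \<^bold>\<and>\<^bsub>K\<^esub> y \<in> H \<and> x \<^bold>\<or>\<^bsub>K\<^esub> y \<in> H)"

definition convex_l_subgroup :: "'a set \<Rightarrow> ('a, 'b) lgroup_scheme \<Rightarrow> bool" where
  "convex_l_subgroup H K \<longleftrightarrow> l_subgroup H K \<and>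
     (\<forall>x\<in>H. \<forall>y\<in>H. \<forall>z\<in>carrier K. x \<preceq>\<^bsub>K\<^esub> z \<and> z \<preceq>\<^bsub>K\<^esub> y \<longrightarrow> z \<in> H)"

definition principal_convex :: "('a, 'b) lgroup_scheme \<Rightarrow> 'a \<Rightarrow> 'a set" where
  "principal_convex K a =
     {b \<in> carrier K. \<exists>n::nat. labs K b \<preceq>\<^bsub>K\<^esub> labs K a [^]\<^bsub>K\<^esub> n}"

definition polar :: "('a, 'b) lgroup_scheme \<Rightarrow> 'a set \<Rightarrow> 'a set" where
  "polar K S = {h \<in> carrier K. \<forall>s\<in>S. labs K h \<^bold>\<and>\<^bsub>K\<^esub> labs K s = \<one>\<^bsub>K\<^esub>}"

definition class_M :: "('a, 'b) lgroup_scheme \<Rightarrow> bool" where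
  "class_M K \<longleftrightarrow> (\<forall>H. convex_l_subgroup H K \<longrightarrow> (\<forall>a\<in>H. polar K (polar K {a}) \<subseteq> H))"

definition Max_lgroup :: "('a, 'b) lgroup_scheme \<Rightarrow> 'a set set" where
  "Max_lgroup K = {m. convex_l_subgroup m K \<and> m \<noteq> carrier K \<and>
     (\<forall>H. convex_l_subgroup H K \<and> H \<noteq> carrier K \<and> m \<subseteq> H \<longrightarrow> H = m)}"

text \<open>Intersecting with \<^term>\<open>carrier K\<close> makes the empty intersection equal to \<open>K\<close>.\<close>

definition class_Y :: "('a, 'b) lgroup_scheme \<Rightarrow> bool" where
  "class_Y K \<longleftrightarrow>
     (\<forall>a\<in>carrier K. \<exists>A \<subseteq> Max_lgroup K. principal_convex K a = carrier K \<inter> \<Inter>A)"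

definition Spec_lgroup :: "('a, 'b) lgroup_scheme \<Rightarrow> 'a set set" where
  "Spec_lgroup K = {p. convex_l_subgroup p K \<and> p \<noteq> carrier K \<and>
     (\<forall>a\<in>carrier K. \<forall>b\<in>carrier K. a \<^bold>\<and>\<^bsub>K\<^esub> b = \<one>\<^bsub>K\<^esub> \<longrightarrow> a \<in> p \<or> b \<in> p)}"


section \<open>The patch topology\<close>

text \<open>
  In an abelian lattice-ordered group the generating sets are closed under binary intersections
  (use \<open>|a| \<and> |a'|\<close> and \<open>|b| \<or> |b'|\<close>) and cover the spectrum, so they form a base.
\<close>

definition patch_topology :: "('a, 'b) lgroup_scheme \<Rightarrow> 'a set topology" where
  "patch_topology G = topology_generated_by
     {{p \<in> Spec_lgroup G. a \<notin> p \<and> b \<in> p} |a b. a \<in> carrier G \<and> b \<in> carrier G}"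

definition dense_subset :: "'a topology \<Rightarrow> 'a set \<Rightarrow> bool" where
  "dense_subset X D \<longleftrightarrow> D \<subseteq> topspace X \<and> X closure_of D = topspace X"


section \<open>The \<open>G + B\<close> construction\<close>

text \<open>The order on \<open>G/p\<close> is the image of the order of \<open>G\<close>.\<close>

definition quot_lgroup :: "('a, 'b) lgroup_scheme \<Rightarrow> 'a set \<Rightarrow> 'a set lgroup" where
  "quot_lgroup G p =
     monoid.extend (G Mod p) (lgroup.fields (\<lambda>X Y. \<exists>x\<in>X. \<exists>y\<in>Y. x \<preceq>\<^bsub>G\<^esub> y))"

definition product_lgroup :: "'i set \<Rightarrow> ('i \<Rightarrow> ('a, 'b) lgroup_scheme) \<Rightarrow> ('i \<Rightarrow> 'a) lgroup" where
  "product_lgroup I L =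
     monoid.extend (product_group I L) (lgroup.fields (\<lambda>x y. \<forall>i\<in>I. x i \<preceq>\<^bsub>L i\<^esub> y i))"

definition GPN_index :: "'a set set \<Rightarrow> ('a set \<times> nat) set" where
  "GPN_index P = P \<times> UNIV"

definition GPN_factor :: "('a, 'b) lgroup_scheme \<Rightarrow> 'a set \<times> nat \<Rightarrow> 'a set lgroup" where
  "GPN_factor G = (\<lambda>(p, n). quot_lgroup G p)"

definition GPN :: "('a, 'b) lgroup_scheme \<Rightarrow> 'a set set \<Rightarrow> ('a set \<times> nat \<Rightarrow> 'a set) lgroup" where
  "GPN G P = product_lgroup (GPN_index P) (GPN_factor G)"

definition hat :: "('a, 'b) lgroup_scheme \<Rightarrow> 'a set set \<Rightarrow> 'a \<Rightarrow> ('a set \<times> nat \<Rightarrow> 'a set)" where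
  "hat G P g = (\<lambda>(p, n)\<in>GPN_index P. p #>\<^bsub>G\<^esub> g)"

definition B_sum :: "('a, 'b) lgroup_scheme \<Rightarrow> 'a set set \<Rightarrow> ('a set \<times> nat \<Rightarrow> 'a set) set" where
  "B_sum G P = carrier (sum_group (GPN_index P) (GPN_factor G))"

definition l_subgroup_generated :: "('a, 'b) lgroup_scheme \<Rightarrow> 'a set \<Rightarrow> 'a set" where
  "l_subgroup_generated K S = \<Inter>{H. l_subgroup H K \<and> S \<subseteq> H}"

definition G_plus_B ::
  "('a, 'b) lgroup_scheme \<Rightarrow> 'a set set \<Rightarrow> ('a set \<times> nat \<Rightarrow> 'a set) lgroup" where
  "G_plus_B G P =
     (GPN G P)\<lparr>carrier := l_subgroup_generated (GPN G P) (hat G P ` carrier G \<union> B_sum G P)\<rparr>"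

end

theory Submission
  imports Defs
begin

text \<open>
  By the prime separation theorem, \<open>P\<close> is patch dense in \<open>Spec(G)\<close> iff every principal convex
  \<open>\<ell>\<close>-subgroup \<open>G(b)\<close> is the intersection of the members of \<open>P\<close> containing \<open>b\<close>.  For
  \<open>P \<subseteq> Max(G)\<close> this gives (Y) and density in \<open>Max(G)\<close>; conversely, under (Y) a maximal convex
  \<open>\<ell>\<close>-subgroup containing \<open>b\<close> but not \<open>a \<notin> G(b)\<close> can be approximated by members of \<open>P\<close>.

  The elements of \<open>G + B\<close> are the families that agree with some \<open>hat g\<close> at all but finitely many
  indices.  Since the factors are totally ordered and \<open>B\<close> contains every element supported at one
  index, the bipolar of \<open>k\<close> consists of all \<open>h\<close> whose support is contained in that of \<open>k\<close>.
  Applying (M) to elements supported at \<open>(p, 0)\<close> shows that \<open>G/p\<close> has no proper nontrivial convex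
  subgroup, i.e. \<open>p\<close> is maximal; applying it to \<open>hat b\<close> gives density.  Conversely, let the support
  of \<open>h\<close> lie in that of \<open>k\<close>, where \<open>h, k\<close> agree almost everywhere with \<open>hat f, hat g\<close>.  As each
  \<open>p\<close> occurs with infinitely many indices, \<open>g \<in> p\<close> implies \<open>f \<in> p\<close>, so \<open>f \<in> G(g)\<close>; at the
  finitely many exceptional indices one uses that \<open>G/p\<close> is archimedean.
\<close>

section \<open>Abelian lattice-ordered groups\<close>

lemma ord_of_simps [simp]:
  "carrier (ord_of K) = carrier K" "le (ord_of K) = lle K" "eq (ord_of K) = (=)"
  by (simp_all add: ord_of_def)

context abelian_lgroup
begin

section \<open>Order and lattice laws\<close>

lemma lle_refl [simp]: "x \<in> carrier K \<Longrightarrow> x \<preceq> x"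
  using order.le_refl by simp

lemma lle_trans [trans]:
  "\<lbrakk>x \<preceq> y; y \<preceq> z; x \<in> carrier K; y \<in> carrier K; z \<in> carrier K\<rbrakk> \<Longrightarrow> x \<preceq> z"
  using order.le_trans by simp

lemma lle_antisym: "\<lbrakk>x \<preceq> y; y \<preceq> x; x \<in> carrier K; y \<in> carrier K\<rbrakk> \<Longrightarrow> x = y"
  using order.le_antisym by simp

lemma ljoin_closed [simp]: "\<lbrakk>x \<in> carrier K; y \<in> carrier K\<rbrakk> \<Longrightarrow> x \<^bold>\<or> y \<in> carrier K"
  using order.join_closed by simp

lemma lmeet_closed [simp]: "\<lbrakk>x \<in> carrier K; y \<in> carrier K\<rbrakk> \<Longrightarrow> x \<^bold>\<and> y \<in> carrier K"
  using order.meet_closed by simp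

lemma ljoin_upper1 [simp]: "\<lbrakk>x \<in> carrier K; y \<in> carrier K\<rbrakk> \<Longrightarrow> x \<preceq> x \<^bold>\<or> y"
  using order.join_left by simp

lemma ljoin_upper2 [simp]: "\<lbrakk>x \<in> carrier K; y \<in> carrier K\<rbrakk> \<Longrightarrow> y \<preceq> x \<^bold>\<or> y"
  using order.join_right by simp

lemma ljoin_least:
  "\<lbrakk>x \<preceq> z; y \<preceq> z; x \<in> carrier K; y \<in> carrier K; z \<in> carrier K\<rbrakk> \<Longrightarrow> x \<^bold>\<or> y \<preceq> z"
  using order.join_le by simp

lemma lmeet_lower1 [simp]: "\<lbrakk>x \<in> carrier K; y \<in> carrier K\<rbrakk> \<Longrightarrow> x \<^bold>\<and> y \<preceq> x"
  using order.meet_left by simp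

lemma lmeet_lower2 [simp]: "\<lbrakk>x \<in> carrier K; y \<in> carrier K\<rbrakk> \<Longrightarrow> x \<^bold>\<and> y \<preceq> y"
  using order.meet_right by simp

lemma lmeet_greatest:
  "\<lbrakk>z \<preceq> x; z \<preceq> y; x \<in> carrier K; y \<in> carrier K; z \<in> carrier K\<rbrakk> \<Longrightarrow> z \<preceq> x \<^bold>\<and> y"
  using order.meet_le by simp

lemma ljoin_eqI:
  assumes "x \<in> carrier K" "y \<in> carrier K" "s \<in> carrier K" "x \<preceq> s" "y \<preceq> s"
    and "\<And>z. \<lbrakk>z \<in> carrier K; x \<preceq> z; y \<preceq> z\<rbrakk> \<Longrightarrow> s \<preceq> z"
  shows "x \<^bold>\<or> y = s"
  using assms by (intro lle_antisym) (auto intro: ljoin_least)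

lemma lmeet_eqI:
  assumes "x \<in> carrier K" "y \<in> carrier K" "s \<in> carrier K" "s \<preceq> x" "s \<preceq> y"
    and "\<And>z. \<lbrakk>z \<in> carrier K; z \<preceq> x; z \<preceq> y\<rbrakk> \<Longrightarrow> z \<preceq> s"
  shows "x \<^bold>\<and> y = s"
  using assms by (intro lle_antisym) (auto intro: lmeet_greatest)

lemma lmeet_absorb: "\<lbrakk>x \<preceq> y; x \<in> carrier K; y \<in> carrier K\<rbrakk> \<Longrightarrow> x \<^bold>\<and> y = x"
  by (rule lmeet_eqI) auto

lemma lmeet_commute: "x \<^bold>\<and> y = y \<^bold>\<and> x"
  by (rule meet_comm)

section \<open>Compatibility of the order with multiplication\<close>

lemma mult_mono2:
  assumes "x \<preceq> y" "z \<preceq> w" "x \<in> carrier K" "y \<in> carrier K" "z \<in> carrier K" "w \<in> carrier K"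
  shows "x \<otimes> z \<preceq> y \<otimes> w"
proof -
  have "x \<otimes> z \<preceq> y \<otimes> z" using assms by (intro mult_mono)
  also have "y \<otimes> z \<preceq> y \<otimes> w"
    using mult_mono[of z w y] assms by (simp add: m_comm)
  finally show ?thesis using assms by simp
qed

lemma mult_le_cancel:
  assumes "x \<in> carrier K" "y \<in> carrier K" "z \<in> carrier K"
  shows "x \<otimes> z \<preceq> y \<otimes> z \<longleftrightarrow> x \<preceq> y"
proof
  assume "x \<otimes> z \<preceq> y \<otimes> z"
  then have "x \<otimes> z \<otimes> inv z \<preceq> y \<otimes> z \<otimes> inv z" using assms by (rule_tac mult_mono) auto
  then show "x \<preceq> y" using assms by (simp add: m_assoc)
qed (use assms mult_mono in blast)

lemma le_mult_iff:
  assumes "x \<in> carrier K" "y \<in> carrier K" "z \<in> carrier K"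
  shows "x \<preceq> z \<otimes> y \<longleftrightarrow> x \<otimes> inv y \<preceq> z"
  using mult_le_cancel[of "x \<otimes> inv y" z y] assms by (simp add: m_assoc)

lemma mult_le_iff:
  assumes "x \<in> carrier K" "y \<in> carrier K" "z \<in> carrier K"
  shows "z \<otimes> y \<preceq> x \<longleftrightarrow> z \<preceq> x \<otimes> inv y"
  using mult_le_cancel[of z "x \<otimes> inv y" y] assms by (simp add: m_assoc)

lemma inv_antimono:
  assumes "x \<preceq> y" "x \<in> carrier K" "y \<in> carrier K"
  shows "inv y \<preceq> inv x"
  using assms le_mult_iff[of x \<one> y] mult_le_iff[of \<one> x "inv y"]
    le_mult_iff[of x y \<one>] by (simp add: m_comm)

text \<open>Translation by \<open>z\<close> is an order automorphism with translation by
  \<open>inv z\<close> as its inverse, so it preserves meets.\<close>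

lemma lmeet_mult:
  assumes "x \<in> carrier K" "y \<in> carrier K" "z \<in> carrier K"
  shows "(x \<^bold>\<and> y) \<otimes> z = (x \<otimes> z) \<^bold>\<and> (y \<otimes> z)"
proof (rule lmeet_eqI[symmetric])
  fix w assume "w \<in> carrier K" "w \<preceq> x \<otimes> z" "w \<preceq> y \<otimes> z"
  then show "w \<preceq> (x \<^bold>\<and> y) \<otimes> z"
    using assms by (auto simp: le_mult_iff intro: lmeet_greatest)
qed (use assms in \<open>auto simp: mult_le_cancel\<close>)

lemma mult_ge_one:
  "\<lbrakk>\<one> \<preceq> x; \<one> \<preceq> y; x \<in> carrier K; y \<in> carrier K\<rbrakk> \<Longrightarrow> \<one> \<preceq> x \<otimes> y"
  using mult_mono2[of \<one> x \<one> y] by simp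

lemma le_mult_right:
  "\<lbrakk>x \<preceq> y; \<one> \<preceq> z; x \<in> carrier K; y \<in> carrier K; z \<in> carrier K\<rbrakk> \<Longrightarrow> x \<preceq> y \<otimes> z"
  using mult_mono2[of x y \<one> z] by simp

lemma pow_ge_one: "\<lbrakk>\<one> \<preceq> x; x \<in> carrier K\<rbrakk> \<Longrightarrow> \<one> \<preceq> x [^] (n::nat)"
  by (induction n) (auto intro: mult_ge_one)

lemma pow_mono_exp:
  assumes "m \<le> n" "\<one> \<preceq> x" "x \<in> carrier K"
  shows "x [^] (m::nat) \<preceq> x [^] n"
proof -
  have "x [^] m \<preceq> x [^] m \<otimes> x [^] (n - m)" using assms by (intro le_mult_right pow_ge_one) auto
  then show ?thesis using assms by (simp add: nat_pow_mult)
qed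

section \<open>Absolute values and disjointness\<close>

lemma labs_closed [simp]: "x \<in> carrier K \<Longrightarrow> labs K x \<in> carrier K"
  by (simp add: labs_def)

lemma le_labs: "x \<in> carrier K \<Longrightarrow> x \<preceq> labs K x"
  by (simp add: labs_def)

lemma inv_le_labs: "x \<in> carrier K \<Longrightarrow> inv x \<preceq> labs K x"
  by (simp add: labs_def)

lemma labs_least:
  "\<lbrakk>x \<preceq> z; inv x \<preceq> z; x \<in> carrier K; z \<in> carrier K\<rbrakk> \<Longrightarrow> labs K x \<preceq> z"
  by (simp add: labs_def ljoin_least)

lemma labs_inv: "x \<in> carrier K \<Longrightarrow> labs K (inv x) = labs K x"
  by (simp add: labs_def join_comm)

text \<open>\<open>\<bar>x\<bar>\<^sup>2 \<ge> x \<otimes> inv x = \<one>\<close>, and an element whose square is positive is positive: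
  for \<open>y = \<bar>x\<bar> \<and> \<one>\<close> one has \<open>y \<otimes> y = \<bar>x\<bar>\<^sup>2 \<and> \<bar>x\<bar> \<and> \<one> = y\<close>.\<close>

lemma labs_ge_one [simp]:
  assumes x: "x \<in> carrier K"
  shows "\<one> \<preceq> labs K x"
proof -
  define a where "a = labs K x"
  define y where "y = a \<^bold>\<and> \<one>"
  have a: "a \<in> carrier K" and y: "y \<in> carrier K" using x by (auto simp: a_def y_def)
  have aa: "\<one> \<preceq> a \<otimes> a"
    using mult_mono2[OF le_labs[OF x] inv_le_labs[OF x]] x by (simp add: a_def)
  have "y \<preceq> y \<otimes> y"
  proof -
    have "y \<otimes> y = (a \<otimes> y) \<^bold>\<and> y" using lmeet_mult[of a \<one> y] a y by (simp add: y_def)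
    moreover have "a \<otimes> y = (a \<otimes> a) \<^bold>\<and> a" using lmeet_mult[of a \<one> a] a y by (simp add: y_def m_comm)
    moreover have "y \<preceq> a \<otimes> a" using lle_trans[OF _ aa, of y] a by (simp add: y_def)
    moreover have "y \<preceq> a" using a by (simp add: y_def)
    ultimately show ?thesis using a y by (auto intro!: lmeet_greatest)
  qed
  then have "\<one> \<preceq> y" using mult_le_cancel[of \<one> y y] y by simp
  then show ?thesis using lle_trans[of \<one> y a] a y by (simp add: a_def y_def)
qed

lemma labs_of_ge_one:
  assumes "\<one> \<preceq> x" "x \<in> carrier K"
  shows "labs K x = x"
proof -
  have "inv x \<preceq> x" using assms inv_antimono[of \<one> x] lle_trans[of "inv x" \<one> x] by simp
  then show ?thesis using assms by (intro lle_antisym labs_least le_labs) auto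
qed

lemma labs_labs [simp]: "x \<in> carrier K \<Longrightarrow> labs K (labs K x) = labs K x"
  by (simp add: labs_of_ge_one)

lemma labs_one [simp]: "labs K \<one> = \<one>"
  by (simp add: labs_of_ge_one)

lemma labs_eq_one_iff:
  assumes "x \<in> carrier K"
  shows "labs K x = \<one> \<longleftrightarrow> x = \<one>"
proof
  assume "labs K x = \<one>"
  then have "x \<preceq> \<one>" "inv x \<preceq> \<one>" using assms le_labs inv_le_labs by metis+
  then show "x = \<one>" using inv_antimono[of "inv x" \<one>] assms by (auto intro: lle_antisym)
qed simp

lemma labs_mult:
  assumes "x \<in> carrier K" "y \<in> carrier K"
  shows "labs K (x \<otimes> y) \<preceq> labs K x \<otimes> labs K y"
  using assms by (intro labs_least) (auto simp: inv_mult intro!: mult_mono2 le_labs inv_le_labs)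

lemma labs_le_iff:
  assumes "x \<in> carrier K" "z \<in> carrier K"
  shows "labs K x \<preceq> z \<longleftrightarrow> x \<preceq> z \<and> inv x \<preceq> z"
  using assms by (meson inv_closed inv_le_labs labs_closed labs_least le_labs lle_trans)

text \<open>The left side \<open>w\<close> lies below the meet of \<open>x\<close> and
  \<open>y\<close> multiplied by \<open>z\<close>, and also below that meet multiplied by
  \<open>x\<close>. Taking the meet of the two bounds commutes with the translation. The inequality
  lets disjointness pass to products.\<close>

lemma lmeet_mult_le:
  assumes "\<one> \<preceq> x" "\<one> \<preceq> y" "\<one> \<preceq> z" "x \<in> carrier K" "y \<in> carrier K" "z \<in> carrier K"
  shows "x \<^bold>\<and> (y \<otimes> z) \<preceq> (x \<^bold>\<and> y) \<otimes> (x \<^bold>\<and> z)"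
proof -
  define w where "w = x \<^bold>\<and> (y \<otimes> z)"
  have w: "w \<in> carrier K" "w \<preceq> x" "w \<preceq> y \<otimes> z" using assms by (auto simp: w_def)
  have "w \<preceq> (x \<^bold>\<and> y) \<otimes> z"
    using assms w by (auto simp: lmeet_mult intro!: lmeet_greatest le_mult_right)
  moreover have "w \<preceq> x \<otimes> (x \<^bold>\<and> y)"
    using assms w by (auto intro!: le_mult_right lmeet_greatest)
  ultimately have "w \<preceq> (x \<otimes> (x \<^bold>\<and> y)) \<^bold>\<and> (z \<otimes> (x \<^bold>\<and> y))"
    using assms w by (auto simp: m_comm intro!: lmeet_greatest)
  then show ?thesis using assms by (simp add: w_def m_comm flip: lmeet_mult)
qed

lemma lmeet_mult_eq_one:
  assumes "x \<^bold>\<and> y = \<one>" "x \<^bold>\<and> z = \<one>" "x \<in> carrier K" "y \<in> carrier K" "z \<in> carrier K"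
  shows "x \<^bold>\<and> (y \<otimes> z) = \<one>"
proof -
  have "\<one> \<preceq> x" "\<one> \<preceq> y" "\<one> \<preceq> z" using assms by (metis lmeet_lower1 lmeet_lower2)+
  then show ?thesis
    using assms lmeet_mult_le[of x y z]
    by (intro lle_antisym) (auto intro!: lmeet_greatest mult_ge_one)
qed

lemma lmeet_pow_eq_one:
  assumes "x \<^bold>\<and> y = \<one>" "x \<in> carrier K" "y \<in> carrier K"
  shows "x [^] (m::nat) \<^bold>\<and> y [^] (n::nat) = \<one>"
proof -
  \<comment> \<open>One exponent is raised at a time: the claim is used first with \<open>y\<close>
    fixed and then with the power of \<open>x\<close> fixed. Exponent zero needs \<open>u\<close> to
    be positive, which holds because \<open>\<one>\<close> is the meet.\<close>
  have *: "u \<^bold>\<and> v [^] (k::nat) = \<one>" if "u \<^bold>\<and> v = \<one>" "u \<in> carrier K" "v \<in> carrier K" for u v k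
  proof (induction k)
    case 0
    have "\<one> \<preceq> u" using that by (metis lmeet_lower1)
    then show ?case using that by (auto intro: lmeet_eqI)
  next
    case (Suc k)
    then show ?case using that by (simp add: lmeet_mult_eq_one)
  qed
  have "y \<^bold>\<and> x [^] m = \<one>" using * assms by (simp add: lmeet_commute)
  then show ?thesis using *[of "x [^] m" y n] assms by (simp add: lmeet_commute)
qed


subsection \<open>Convex subgroups and primes\<close>

lemma labs_ljoin_le:
  assumes "x \<in> carrier K" "y \<in> carrier K"
  shows "labs K (x \<^bold>\<or> y) \<preceq> labs K x \<otimes> labs K y"
proof (rule labs_least)
  show "x \<^bold>\<or> y \<preceq> labs K x \<otimes> labs K y"
    using assms le_mult_right[of x "labs K x" "labs K y"] le_mult_right[of y "labs K y" "labs K x"]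
    by (auto simp: le_labs m_comm intro!: ljoin_least)
  have "inv (x \<^bold>\<or> y) \<preceq> inv x" using assms by (intro inv_antimono) auto
  also have "inv x \<preceq> labs K x \<otimes> labs K y" using assms by (intro le_mult_right inv_le_labs) auto
  finally show "inv (x \<^bold>\<or> y) \<preceq> labs K x \<otimes> labs K y" using assms by simp
qed (use assms in auto)

text \<open>Inversion is an order-reversing involution and therefore exchanges joins and
  meets.\<close>

lemma lmeet_eq_inv_ljoin:
  assumes "x \<in> carrier K" "y \<in> carrier K"
  shows "x \<^bold>\<and> y = inv (inv x \<^bold>\<or> inv y)"
proof (rule lmeet_eqI)
  show "inv (inv x \<^bold>\<or> inv y) \<preceq> x" "inv (inv x \<^bold>\<or> inv y) \<preceq> y"
    using assms inv_antimono[of "inv x" "inv x \<^bold>\<or> inv y"] inv_antimono[of "inv y" "inv x \<^bold>\<or> inv y"]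
    by auto
  fix z assume z: "z \<in> carrier K" "z \<preceq> x" "z \<preceq> y"
  then have "inv x \<^bold>\<or> inv y \<preceq> inv z" using assms by (auto intro: ljoin_least inv_antimono)
  then show "z \<preceq> inv (inv x \<^bold>\<or> inv y)" using z assms inv_antimono[of "inv x \<^bold>\<or> inv y" "inv z"] by simp
qed (use assms in auto)

text \<open>Solidity packs lattice closure and convexity into one condition on absolute values. A
  join is bounded by the product of the absolute values of \<open>x\<close> and \<open>y\<close>, a
  meet is an inverse of a join, and an element between \<open>x\<close> and \<open>y\<close> obeys
  the same bound as the join.\<close>

lemma convex_l_subgroup_iff:
  "convex_l_subgroup H K \<longleftrightarrow>
     subgroup H K \<and> (\<forall>h\<in>H. \<forall>z\<in>carrier K. labs K z \<preceq> labs K h \<longrightarrow> z \<in> H)"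
proof
  assume H: "convex_l_subgroup H K"
  then have sub: "subgroup H K" by (simp add: convex_l_subgroup_def l_subgroup_def)
  have "z \<in> H" if "h \<in> H" and z: "z \<in> carrier K" and le: "labs K z \<preceq> labs K h" for h z
  proof -
    have h: "h \<in> carrier K" using sub \<open>h \<in> H\<close> by (rule subgroup.mem_carrier)
    have absh: "labs K h \<in> H"
      using H \<open>h \<in> H\<close> subgroup.m_inv_closed[OF sub \<open>h \<in> H\<close>]
      unfolding labs_def convex_l_subgroup_def l_subgroup_def by blast
    have "z \<preceq> labs K h" using lle_trans[OF le_labs le] z h by simp
    moreover have "inv (labs K h) \<preceq> z"
      using z h le inv_antimono[of "inv z" "labs K h"] labs_le_iff by auto
    ultimately show ?thesis
      using H z absh subgroup.m_inv_closed[OF sub absh] unfolding convex_l_subgroup_def by blast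
  qed
  with sub show "subgroup H K \<and> (\<forall>h\<in>H. \<forall>z\<in>carrier K. labs K z \<preceq> labs K h \<longrightarrow> z \<in> H)"
    by blast
next
  assume "subgroup H K \<and> (\<forall>h\<in>H. \<forall>z\<in>carrier K. labs K z \<preceq> labs K h \<longrightarrow> z \<in> H)"
  then have sub: "subgroup H K"
    and solid: "\<And>h z. \<lbrakk>h \<in> H; z \<in> carrier K; labs K z \<preceq> labs K h\<rbrakk> \<Longrightarrow> z \<in> H" by blast+
  have car: "x \<in> carrier K" if "x \<in> H" for x using sub that by (rule subgroup.mem_carrier)
  have absH: "labs K x \<in> H" if "x \<in> H" for x
    using car[OF that] by (intro solid[OF that]) simp_all
  \<comment> \<open>A product of absolute values is positive and hence its own absolute value, so
    \<open>solid\<close> applies to it.\<close>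
  have dom: "z \<in> H" if "x \<in> H" "y \<in> H" "z \<in> carrier K" "labs K z \<preceq> labs K x \<otimes> labs K y" for x y z
    using that car[OF that(1)] car[OF that(2)] subgroup.m_closed[OF sub absH absH, of x y]
    by (rule_tac solid[of "labs K x \<otimes> labs K y"]) (simp_all add: labs_of_ge_one mult_ge_one)
  have joinH: "x \<^bold>\<or> y \<in> H" if "x \<in> H" "y \<in> H" for x y
    using car[OF that(1)] car[OF that(2)] by (intro dom[OF that]) (simp_all add: labs_ljoin_le)
  have "x \<^bold>\<and> y \<in> H" if "x \<in> H" "y \<in> H" for x y
    using that car[OF that(1)] car[OF that(2)]
    by (simp add: lmeet_eq_inv_ljoin joinH subgroup.m_inv_closed[OF sub])
  moreover have "z \<in> H" if "x \<in> H" "y \<in> H" "z \<in> carrier K" "x \<preceq> z" "z \<preceq> y" for x y z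
  proof (rule dom[OF that(1,2,3)], rule labs_least)
    have c: "x \<in> carrier K" "y \<in> carrier K" using car that(1,2) by blast+
    have "z \<preceq> y" by fact
    also have "y \<preceq> labs K y \<otimes> labs K x" using c by (intro le_mult_right le_labs) simp_all
    finally show "z \<preceq> labs K x \<otimes> labs K y"
      using that(3) c by (simp add: m_comm)
    have "inv z \<preceq> inv x" using that c by (intro inv_antimono) simp_all
    also have "inv x \<preceq> labs K x \<otimes> labs K y" using c by (intro le_mult_right inv_le_labs) simp_all
    finally show "inv z \<preceq> labs K x \<otimes> labs K y" using that(3) c by simp
    show "z \<in> carrier K" "labs K x \<otimes> labs K y \<in> carrier K" using that(3) c by simp_all
  qed
  ultimately show "convex_l_subgroup H K"
    using sub joinH unfolding convex_l_subgroup_def l_subgroup_def by blast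
qed

lemma convex_subgroup: "convex_l_subgroup H K \<Longrightarrow> subgroup H K"
  by (simp add: convex_l_subgroup_iff)

lemma convex_mem_carrier: "\<lbrakk>convex_l_subgroup H K; x \<in> H\<rbrakk> \<Longrightarrow> x \<in> carrier K"
  by (rule subgroup.mem_carrier[OF convex_subgroup])

lemma convex_mult_closed: "\<lbrakk>convex_l_subgroup H K; x \<in> H; y \<in> H\<rbrakk> \<Longrightarrow> x \<otimes> y \<in> H"
  by (rule subgroup.m_closed[OF convex_subgroup])

lemma convex_one_closed: "convex_l_subgroup H K \<Longrightarrow> \<one> \<in> H"
  by (rule subgroup.one_closed[OF convex_subgroup])

lemma convex_pow_closed: "\<lbrakk>convex_l_subgroup H K; x \<in> H\<rbrakk> \<Longrightarrow> x [^] (n::nat) \<in> H"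
  by (induction n) (simp_all add: convex_one_closed convex_mult_closed)

lemma convex_solid:
  "\<lbrakk>convex_l_subgroup H K; h \<in> H; z \<in> carrier K; labs K z \<preceq> labs K h\<rbrakk> \<Longrightarrow> z \<in> H"
  using convex_l_subgroup_iff by blast

lemma convex_labs_iff:
  "\<lbrakk>convex_l_subgroup H K; x \<in> carrier K\<rbrakk> \<Longrightarrow> labs K x \<in> H \<longleftrightarrow> x \<in> H"
  using convex_solid[of H x "labs K x"] convex_solid[of H "labs K x" x] by auto

lemma convex_le:
  assumes "convex_l_subgroup H K" "h \<in> H" "\<one> \<preceq> z" "z \<preceq> h" "z \<in> carrier K"
  shows "z \<in> H"
  using assms convex_one_closed[OF assms(1)] unfolding convex_l_subgroup_def by blast

text \<open>For convex \<open>H\<close> this is the convex l-subgroup generated by \<open>H\<close>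
  and \<open>x\<close>. With \<open>H = {\<one>}\<close> it becomes the principal one, so both are
  treated together.\<close>

definition convex_adjoin :: "'a set \<Rightarrow> 'a \<Rightarrow> 'a set" where
  "convex_adjoin H x =
     {z \<in> carrier K. \<exists>h\<in>H. \<exists>n::nat. labs K z \<preceq> labs K h \<otimes> labs K x [^] n}"

lemma convex_adjoin_convex:
  assumes H: "convex_l_subgroup H K" and x: "x \<in> carrier K"
  shows "convex_l_subgroup (convex_adjoin H x) K"
  unfolding convex_l_subgroup_iff
proof (intro conjI ballI impI)
  note car = convex_mem_carrier[OF H]
  show "subgroup (convex_adjoin H x) K"
  proof
    show "convex_adjoin H x \<subseteq> carrier K" by (auto simp: convex_adjoin_def)
    have "labs K \<one> \<preceq> labs K \<one> \<otimes> labs K x [^] (0::nat)" by simp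
    then show "\<one> \<in> convex_adjoin H x"
      unfolding convex_adjoin_def using convex_one_closed[OF H] by blast
    fix y assume y: "y \<in> convex_adjoin H x"
    then show "inv y \<in> convex_adjoin H x"
      unfolding convex_adjoin_def by (auto simp: labs_inv)
    fix z assume z: "z \<in> convex_adjoin H x"
    obtain h m where h: "h \<in> H" "labs K y \<preceq> labs K h \<otimes> labs K x [^] (m::nat)"
      using y unfolding convex_adjoin_def by blast
    obtain k n where k: "k \<in> H" "labs K z \<preceq> labs K k \<otimes> labs K x [^] (n::nat)"
      using z unfolding convex_adjoin_def by blast
    have yz: "y \<in> carrier K" "z \<in> carrier K" using y z by (auto simp: convex_adjoin_def)
    \<comment> \<open>The witnesses for the product are \<open>?s\<close> and the exponent
      \<open>m + n\<close>; \<open>?s\<close> is positive, so it agrees with its absolute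
      value.\<close>
    let ?s = "labs K h \<otimes> labs K k"
    have s: "?s \<in> H" using h k H car by (intro convex_mult_closed) (auto simp: convex_labs_iff)
    have "labs K (y \<otimes> z) \<preceq> labs K y \<otimes> labs K z" using yz by (rule labs_mult)
    also have "\<dots> \<preceq> (labs K h \<otimes> labs K x [^] m) \<otimes> (labs K k \<otimes> labs K x [^] n)"
      using h k yz x car by (intro mult_mono2) auto
    also have "\<dots> = ?s \<otimes> (labs K x [^] m \<otimes> labs K x [^] n)"
      using h k x car by (simp add: m_ac)
    also have "\<dots> = labs K ?s \<otimes> labs K x [^] (m + n)"
      using h k x car by (simp add: nat_pow_mult labs_of_ge_one mult_ge_one)
    finally have "labs K (y \<otimes> z) \<preceq> labs K ?s \<otimes> labs K x [^] (m + n)"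
      using h k yz x car by simp
    then show "y \<otimes> z \<in> convex_adjoin H x"
      using s yz unfolding convex_adjoin_def by blast
  qed
  fix y z
  assume y: "y \<in> convex_adjoin H x" and z: "z \<in> carrier K" and le: "labs K z \<preceq> labs K y"
  obtain h m where h: "h \<in> H" "labs K y \<preceq> labs K h \<otimes> labs K x [^] (m::nat)"
    using y unfolding convex_adjoin_def by blast
  have "y \<in> carrier K" using y by (simp add: convex_adjoin_def)
  then have "labs K z \<preceq> labs K h \<otimes> labs K x [^] m"
    using h le z x car by (intro lle_trans[OF le h(2)]) auto
  with z h show "z \<in> convex_adjoin H x" unfolding convex_adjoin_def by blast
qed

lemma subset_convex_adjoin:
  assumes H: "convex_l_subgroup H K"
  shows "H \<subseteq> convex_adjoin H x"
proof
  fix h assume h: "h \<in> H"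
  then have "labs K h \<preceq> labs K h \<otimes> labs K x [^] (0::nat)"
    using convex_mem_carrier[OF H] by simp
  with h show "h \<in> convex_adjoin H x"
    unfolding convex_adjoin_def using convex_mem_carrier[OF H] by blast
qed

lemma mem_convex_adjoin:
  assumes H: "convex_l_subgroup H K" and x: "x \<in> carrier K"
  shows "x \<in> convex_adjoin H x"
proof -
  have "labs K x \<preceq> labs K \<one> \<otimes> labs K x [^] (1::nat)" using x by simp
  then show ?thesis unfolding convex_adjoin_def using x convex_one_closed[OF H] by blast
qed

lemma one_convex: "convex_l_subgroup {\<one>} K"
proof -
  have "z = \<one>" if "z \<in> carrier K" "labs K z \<preceq> \<one>" for z
    using that lle_antisym[of "labs K z" \<one>] by (simp add: labs_eq_one_iff)
  then show ?thesis by (simp add: convex_l_subgroup_iff triv_subgroup)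
qed

lemma principal_convex_eq: "a \<in> carrier K \<Longrightarrow> principal_convex K a = convex_adjoin {\<one>} a"
  by (auto simp: principal_convex_def convex_adjoin_def)

lemma principal_convex_convex:
  "a \<in> carrier K \<Longrightarrow> convex_l_subgroup (principal_convex K a) K"
  by (simp add: principal_convex_eq convex_adjoin_convex one_convex)

lemma mem_principal_convex: "a \<in> carrier K \<Longrightarrow> a \<in> principal_convex K a"
  by (simp add: principal_convex_eq mem_convex_adjoin one_convex)

lemma principal_convex_subset:
  assumes H: "convex_l_subgroup H K" and a: "a \<in> H"
  shows "principal_convex K a \<subseteq> H"
proof
  fix b assume "b \<in> principal_convex K a"
  then obtain n :: nat where b: "b \<in> carrier K" "labs K b \<preceq> labs K a [^] n"
    by (auto simp: principal_convex_def)
  have ac: "a \<in> carrier K" using H a by (rule convex_mem_carrier)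
  have "labs K a [^] n \<in> H" using H a ac by (simp add: convex_pow_closed convex_labs_iff)
  then have "labs K b \<in> H" using b by (intro convex_le[OF H _ _ b(2)]) auto
  then show "b \<in> H" using b H by (simp add: convex_labs_iff)
qed

text \<open>The principal convex subgroup of \<open>a\<close> is the least convex l-subgroup
  containing \<open>a\<close>, so (M) need only be tested on it.\<close>

lemma class_M_iff: "class_M K \<longleftrightarrow> (\<forall>a\<in>carrier K. polar K (polar K {a}) \<subseteq> principal_convex K a)"
proof
  assume "class_M K"
  then show "\<forall>a\<in>carrier K. polar K (polar K {a}) \<subseteq> principal_convex K a"
    by (simp add: class_M_def principal_convex_convex mem_principal_convex)
next
  assume *: "\<forall>a\<in>carrier K. polar K (polar K {a}) \<subseteq> principal_convex K a"
  show "class_M K" unfolding class_M_def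
  proof (intro allI impI ballI)
    fix H a assume "convex_l_subgroup H K" "a \<in> H"
    then show "polar K (polar K {a}) \<subseteq> H"
      using * principal_convex_subset[of H a] convex_mem_carrier[of H a] by auto
  qed
qed

section \<open>Prime and maximal convex subgroups\<close>

lemma Spec_convex: "p \<in> Spec_lgroup K \<Longrightarrow> convex_l_subgroup p K"
  by (simp add: Spec_lgroup_def)

text \<open>If every convex \<open>\<ell>\<close>-subgroup strictly above \<open>H\<close> contains \<open>a\<close> and \<open>x \<^bold>\<and> y = \<one>\<close> with
  \<open>x, y \<notin> H\<close>, then \<open>\<bar>a\<bar> \<le> s x\<^sup>m \<^bold>\<and> s y\<^sup>n = s\<close> for some \<open>s \<in> H\<close>.\<close>

lemma Spec_if_maximal_avoiding:
  assumes H: "convex_l_subgroup H K" and a: "a \<in> carrier K" "a \<notin> H"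
    and above: "\<And>H'. \<lbrakk>convex_l_subgroup H' K; H \<subset> H'\<rbrakk> \<Longrightarrow> a \<in> H'"
  shows "H \<in> Spec_lgroup K"
proof -
  note car = convex_mem_carrier[OF H]
  have bound: "\<exists>h\<in>H. \<exists>n::nat. labs K a \<preceq> labs K h \<otimes> x [^] n"
    if "\<one> \<preceq> x" "x \<in> carrier K" "x \<notin> H" for x
  proof -
    have "H \<subset> convex_adjoin H x"
      using subset_convex_adjoin[OF H, of x] mem_convex_adjoin[OF H that(2)] that(3) by blast
    then have "a \<in> convex_adjoin H x"
      using convex_adjoin_convex[OF H that(2)] by (rule_tac above)
    then show ?thesis using that by (simp add: convex_adjoin_def labs_of_ge_one)
  qed
  have "x \<in> H \<or> y \<in> H" if xy: "x \<in> carrier K" "y \<in> carrier K" "x \<^bold>\<and> y = \<one>" for x y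
  proof (rule ccontr)
    assume neg: "\<not> (x \<in> H \<or> y \<in> H)"
    have pos: "\<one> \<preceq> x" "\<one> \<preceq> y" using xy lmeet_lower1[of x y] lmeet_lower2[of x y] by auto
    obtain h m where h: "h \<in> H" "labs K a \<preceq> labs K h \<otimes> x [^] (m::nat)"
      using bound xy pos neg by blast
    obtain k n where k: "k \<in> H" "labs K a \<preceq> labs K k \<otimes> y [^] (n::nat)"
      using bound xy pos neg by blast
    define s where "s = labs K h \<otimes> labs K k"
    have s: "s \<in> H" "s \<in> carrier K" unfolding s_def
      using h k H car[of h] car[of k] by (simp_all add: convex_mult_closed convex_labs_iff)
    have hs: "labs K h \<preceq> s" "labs K k \<preceq> s" unfolding s_def
      using h k car[of h] car[of k] le_mult_right[of "labs K h" "labs K h" "labs K k"]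
        le_mult_right[of "labs K k" "labs K k" "labs K h"] by (simp_all add: m_comm)
    have "labs K h \<otimes> x [^] m \<preceq> x [^] m \<otimes> s" "labs K k \<otimes> y [^] n \<preceq> y [^] n \<otimes> s"
      using h k hs s xy car[of h] car[of k] mult_mono[of "labs K h" s "x [^] m"] mult_mono[of "labs K k" s "y [^] n"]
      by (simp_all add: m_comm)
    then have "labs K a \<preceq> x [^] m \<otimes> s" "labs K a \<preceq> y [^] n \<otimes> s"
      using h k s xy a car[of h] car[of k]
        lle_trans[of "labs K a" "labs K h \<otimes> x [^] m" "x [^] m \<otimes> s"]
        lle_trans[of "labs K a" "labs K k \<otimes> y [^] n" "y [^] n \<otimes> s"] by simp_all
    then have "labs K a \<preceq> (x [^] m \<otimes> s) \<^bold>\<and> (y [^] n \<otimes> s)"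
      using a s xy by (intro lmeet_greatest) auto
    also have "\<dots> = s" using xy s by (simp add: lmeet_pow_eq_one flip: lmeet_mult)
    finally have "labs K a \<in> H" using s a H by (rule_tac convex_le[of H s]) auto
    then show False using a H by (simp add: convex_labs_iff)
  qed
  moreover have "H \<noteq> carrier K" using a by blast
  ultimately show ?thesis using H by (simp add: Spec_lgroup_def)
qed

text \<open>Only the whole group lies strictly above a maximal \<open>m\<close>, so \<open>m\<close>
  is maximal among those avoiding any chosen \<open>a\<close> outside it.\<close>

lemma Max_subset_Spec: "Max_lgroup K \<subseteq> Spec_lgroup K"
proof
  fix m assume m: "m \<in> Max_lgroup K"
  then have c: "convex_l_subgroup m K" by (simp add: Max_lgroup_def)
  then obtain a where a: "a \<in> carrier K" "a \<notin> m"
    using m convex_mem_carrier by (auto simp: Max_lgroup_def)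
  then show "m \<in> Spec_lgroup K"
    using m c by (intro Spec_if_maximal_avoiding[of m a]) (auto simp: Max_lgroup_def)
qed

lemma Union_chain_convex:
  assumes "subset.chain {H. convex_l_subgroup H K} C" "C \<noteq> {}"
  shows "convex_l_subgroup (\<Union>C) K"
proof -
  have conv: "convex_l_subgroup H K" if "H \<in> C" for H
    using assms that by (auto simp: subset.chain_def)
  have "subgroup (\<Union>C) K"
  proof
    show "\<Union>C \<subseteq> carrier K" using conv convex_mem_carrier by blast
    show "\<one> \<in> \<Union>C" using assms conv convex_one_closed by blast
    show "inv x \<in> \<Union>C" if "x \<in> \<Union>C" for x
      using that subgroup.m_inv_closed[OF convex_subgroup[OF conv]] by blast
    show "x \<otimes> y \<in> \<Union>C" if xy: "x \<in> \<Union>C" "y \<in> \<Union>C" for x y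
    proof -
      obtain X Y where XY: "X \<in> C" "x \<in> X" "Y \<in> C" "y \<in> Y" using xy by blast
      then have "X \<subseteq> Y \<or> Y \<subseteq> X" using assms(1) by (auto simp: subset.chain_def)
      then show ?thesis using XY conv convex_mult_closed by blast
    qed
  qed
  moreover have "z \<in> \<Union>C" if "h \<in> \<Union>C" "z \<in> carrier K" "labs K z \<preceq> labs K h" for h z
    using that conv convex_solid by blast
  ultimately show ?thesis by (simp add: convex_l_subgroup_iff)
qed

text \<open>Zorn's lemma gives a convex l-subgroup that is maximal among those containing
  \<open>H\<close> and avoiding \<open>a\<close>, and such a subgroup is prime.\<close>

lemma prime_separation:
  assumes H: "convex_l_subgroup H K" and a: "a \<in> carrier K" "a \<notin> H"
  obtains p where "p \<in> Spec_lgroup K" "H \<subseteq> p" "a \<notin> p"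
proof -
  define F where "F = {H'. convex_l_subgroup H' K \<and> H \<subseteq> H' \<and> a \<notin> H'}"
  have "\<exists>M\<in>F. \<forall>X\<in>F. M \<subseteq> X \<longrightarrow> X = M"
  proof (rule subset_Zorn_nonempty)
    show "F \<noteq> {}" using H a by (auto simp: F_def)
    fix C assume C: "C \<noteq> {}" "subset.chain F C"
    then have "subset.chain {H. convex_l_subgroup H K} C"
      by (auto simp: subset.chain_def F_def)
    then have "convex_l_subgroup (\<Union>C) K" using C by (intro Union_chain_convex)
    then show "\<Union>C \<in> F" using C by (auto simp: F_def subset.chain_def)
  qed
  then obtain M where M: "M \<in> F" "\<And>X. \<lbrakk>X \<in> F; M \<subseteq> X\<rbrakk> \<Longrightarrow> X = M" by blast
  have "M \<in> Spec_lgroup K"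
  proof (rule Spec_if_maximal_avoiding)
    show "a \<in> H'" if "convex_l_subgroup H' K" "M \<subset> H'" for H'
      using that M by (auto simp: F_def)
  qed (use M a in \<open>auto simp: F_def\<close>)
  then show thesis using M that by (auto simp: F_def)
qed

text \<open>Primeness is defined through disjoint pairs. Dividing \<open>x\<close> and
  \<open>y\<close> by their meet makes them disjoint, and multiplying back by the meet stays inside
  \<open>p\<close>.\<close>

lemma Spec_prime:
  assumes p: "p \<in> Spec_lgroup K" and x: "x \<in> carrier K" and y: "y \<in> carrier K"
    and m: "x \<^bold>\<and> y \<in> p"
  shows "x \<in> p \<or> y \<in> p"
proof -
  let ?m = "x \<^bold>\<and> y"
  have "(x \<otimes> inv ?m) \<^bold>\<and> (y \<otimes> inv ?m) = \<one>" using x y by (simp flip: lmeet_mult)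
  then have "x \<otimes> inv ?m \<in> p \<or> y \<otimes> inv ?m \<in> p"
    using p x y by (simp add: Spec_lgroup_def)
  then have "x \<otimes> inv ?m \<otimes> ?m \<in> p \<or> y \<otimes> inv ?m \<otimes> ?m \<in> p"
    using m convex_mult_closed[OF Spec_convex[OF p]] by blast
  then show ?thesis using x y by (simp add: m_assoc)
qed

end


subsection \<open>Subgroups, products and quotients\<close>

text \<open>The ordered products and quotients are other records than \<open>product_group\<close>
  and \<open>Mod\<close>, but share carrier, multiplication and unit with them. Group facts are
  carried over along this agreement.\<close>

lemma comm_group_cong:
  fixes K :: "('a, 'b) monoid_scheme" and L :: "('a, 'c) monoid_scheme"
  assumes "comm_group L" and "carrier K = carrier L"
    and "monoid.mult K = monoid.mult L" and "one K = one L"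
  shows "comm_group K"
proof -
  interpret L: comm_group L by fact
  show ?thesis
    by (rule comm_groupI) (use assms L.l_inv_ex in \<open>auto simp: L.m_ac\<close>)
qed

lemma m_inv_cong:
  assumes "carrier K = carrier L" and "monoid.mult K = monoid.mult L" and "one K = one L"
  shows "m_inv K x = m_inv L x"
  using assms by (simp add: m_inv_def)

lemma nat_pow_cong:
  assumes "monoid.mult K = monoid.mult L" and "one K = one L"
  shows "x [^]\<^bsub>K\<^esub> (n::nat) = x [^]\<^bsub>L\<^esub> n"
  using assms by (simp add: nat_pow_def)

text \<open>Joins are enough: translating by \<open>inv x \<otimes> inv y\<close> shows that
  inversion reverses the order, so the inverse of a join of inverses is a meet.\<close>

lemma abelian_lgroupI:
  fixes K (structure)
  assumes "comm_group K"
    and refl: "\<And>x. x \<in> carrier K \<Longrightarrow> x \<preceq> x"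
    and trans: "\<And>x y z. \<lbrakk>x \<in> carrier K; y \<in> carrier K; z \<in> carrier K; x \<preceq> y; y \<preceq> z\<rbrakk> \<Longrightarrow> x \<preceq> z"
    and antisym: "\<And>x y. \<lbrakk>x \<in> carrier K; y \<in> carrier K; x \<preceq> y; y \<preceq> x\<rbrakk> \<Longrightarrow> x = y"
    and mono: "\<And>x y z. \<lbrakk>x \<in> carrier K; y \<in> carrier K; z \<in> carrier K; x \<preceq> y\<rbrakk> \<Longrightarrow> x \<otimes> z \<preceq> y \<otimes> z"
    and join: "\<And>x y. \<lbrakk>x \<in> carrier K; y \<in> carrier K\<rbrakk> \<Longrightarrow>
      \<exists>s\<in>carrier K. x \<preceq> s \<and> y \<preceq> s \<and> (\<forall>z\<in>carrier K. x \<preceq> z \<and> y \<preceq> z \<longrightarrow> s \<preceq> z)"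
  shows "abelian_lgroup K"
proof -
  interpret comm_group K by fact
  have anti: "inv y \<preceq> inv x" if "x \<in> carrier K" "y \<in> carrier K" "x \<preceq> y" for x y
  proof -
    have "x \<otimes> (inv x \<otimes> inv y) = inv y" "y \<otimes> (inv x \<otimes> inv y) = inv x"
      using that m_assoc[of x "inv x" "inv y"] m_lcomm[of y "inv x" "inv y"] by simp_all
    then show ?thesis using mono[of x y "inv x \<otimes> inv y"] that by simp
  qed
  have meet: "\<exists>s\<in>carrier K. s \<preceq> x \<and> s \<preceq> y \<and> (\<forall>z\<in>carrier K. z \<preceq> x \<and> z \<preceq> y \<longrightarrow> z \<preceq> s)"
    if xy: "x \<in> carrier K" "y \<in> carrier K" for x y
  proof -
    obtain s where s: "s \<in> carrier K" "inv x \<preceq> s" "inv y \<preceq> s"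
      "\<And>z. \<lbrakk>z \<in> carrier K; inv x \<preceq> z; inv y \<preceq> z\<rbrakk> \<Longrightarrow> s \<preceq> z"
      using join[of "inv x" "inv y"] xy by auto
    have "z \<preceq> inv s" if "z \<in> carrier K" "z \<preceq> x" "z \<preceq> y" for z
      using anti[of s "inv z"] s(1) s(4)[of "inv z"] anti[of z x] anti[of z y] that xy by simp
    moreover have "inv s \<preceq> x" "inv s \<preceq> y"
      using anti[OF _ s(1,2)] anti[OF _ s(1,3)] xy by auto
    ultimately show ?thesis using s(1) by (intro bexI[of _ "inv s"]) auto
  qed
  interpret order: Lattice.lattice "ord_of K"
  proof
    fix x y assume xy: "x \<in> carrier (ord_of K)" "y \<in> carrier (ord_of K)"
    show "\<exists>s. least (ord_of K) s (Upper (ord_of K) {x, y})"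
      using join[of x y] xy by (fastforce simp: least_def Upper_def)
    show "\<exists>s. greatest (ord_of K) s (Lower (ord_of K) {x, y})"
      using meet[of x y] xy by (fastforce simp: greatest_def Lower_def)
    show "le (ord_of K) x z" if "le (ord_of K) x y" "le (ord_of K) y z"
      "x \<in> carrier (ord_of K)" "y \<in> carrier (ord_of K)" "z \<in> carrier (ord_of K)" for x y z
      using that trans[of x y z] by simp
  qed (simp_all add: refl antisym)
  show ?thesis by unfold_locales (rule mono)
qed

context abelian_lgroup
begin

lemma sub_abelian_lgroup:
  assumes H: "l_subgroup H K"
  shows "abelian_lgroup (K\<lparr>carrier := H\<rparr>)"
proof (rule abelian_lgroupI)
  have sub: "subgroup H K" using H by (simp add: l_subgroup_def)
  then have car: "\<And>x. x \<in> H \<Longrightarrow> x \<in> carrier K" by (rule subgroup.mem_carrier)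
  interpret S: group "K\<lparr>carrier := H\<rparr>" using sub by (rule subgroup_imp_group)
  show "comm_group (K\<lparr>carrier := H\<rparr>)"
    by (rule S.group_comm_groupI) (simp add: m_comm car)
  show "\<exists>s\<in>carrier (K\<lparr>carrier := H\<rparr>). lle (K\<lparr>carrier := H\<rparr>) x s \<and> lle (K\<lparr>carrier := H\<rparr>) y s \<and>
      (\<forall>z\<in>carrier (K\<lparr>carrier := H\<rparr>). lle (K\<lparr>carrier := H\<rparr>) x z \<and> lle (K\<lparr>carrier := H\<rparr>) y z \<longrightarrow>
        lle (K\<lparr>carrier := H\<rparr>) s z)"
    if "x \<in> carrier (K\<lparr>carrier := H\<rparr>)" "y \<in> carrier (K\<lparr>carrier := H\<rparr>)" for x y
    using that H by (intro bexI[of _ "x \<^bold>\<or> y"]) (simp_all add: l_subgroup_def car ljoin_least)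
  show "x = y" if "x \<in> carrier (K\<lparr>carrier := H\<rparr>)" "y \<in> carrier (K\<lparr>carrier := H\<rparr>)"
    "lle (K\<lparr>carrier := H\<rparr>) x y" "lle (K\<lparr>carrier := H\<rparr>) y x" for x y
    using that by (intro lle_antisym) (simp_all add: car)
  show "lle (K\<lparr>carrier := H\<rparr>) x z"
    if "x \<in> carrier (K\<lparr>carrier := H\<rparr>)" "y \<in> carrier (K\<lparr>carrier := H\<rparr>)" "z \<in> carrier (K\<lparr>carrier := H\<rparr>)"
      "lle (K\<lparr>carrier := H\<rparr>) x y" "lle (K\<lparr>carrier := H\<rparr>) y z" for x y z
    using that lle_trans[of x y z] by (simp add: car)
qed (use H subgroup.mem_carrier[of H K] in \<open>auto simp: l_subgroup_def intro: mult_mono\<close>)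

text \<open>A join is a least upper bound relative to the carrier, so it could change in a smaller
  group. Closure of \<open>H\<close> under the joins of \<open>K\<close> makes the two
  agree.\<close>

lemma sub_ljoin:
  assumes H: "l_subgroup H K" and x: "x \<in> H" "y \<in> H"
  shows "x \<^bold>\<or>\<^bsub>K\<lparr>carrier := H\<rparr>\<^esub> y = x \<^bold>\<or> y"
proof (rule abelian_lgroup.ljoin_eqI[OF sub_abelian_lgroup[OF H]])
  have car: "\<And>x. x \<in> H \<Longrightarrow> x \<in> carrier K"
    using H subgroup.mem_carrier[of H K] by (simp add: l_subgroup_def)
  show "lle (K\<lparr>carrier := H\<rparr>) (x \<^bold>\<or> y) z"
    if "z \<in> carrier (K\<lparr>carrier := H\<rparr>)" "lle (K\<lparr>carrier := H\<rparr>) x z" "lle (K\<lparr>carrier := H\<rparr>) y z" for z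
    using that x by (simp add: car ljoin_least)
qed (use assms subgroup.mem_carrier[of H K] in \<open>simp_all add: l_subgroup_def\<close>)

lemma sub_lmeet:
  assumes H: "l_subgroup H K" and x: "x \<in> H" "y \<in> H"
  shows "x \<^bold>\<and>\<^bsub>K\<lparr>carrier := H\<rparr>\<^esub> y = x \<^bold>\<and> y"
proof (rule abelian_lgroup.lmeet_eqI[OF sub_abelian_lgroup[OF H]])
  have car: "\<And>x. x \<in> H \<Longrightarrow> x \<in> carrier K"
    using H subgroup.mem_carrier[of H K] by (simp add: l_subgroup_def)
  show "lle (K\<lparr>carrier := H\<rparr>) z (x \<^bold>\<and> y)"
    if "z \<in> carrier (K\<lparr>carrier := H\<rparr>)" "lle (K\<lparr>carrier := H\<rparr>) z x" "lle (K\<lparr>carrier := H\<rparr>) z y" for z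
    using that x by (simp add: car lmeet_greatest)
qed (use assms subgroup.mem_carrier[of H K] in \<open>simp_all add: l_subgroup_def\<close>)

lemma sub_labs:
  assumes H: "l_subgroup H K" and x: "x \<in> H"
  shows "labs (K\<lparr>carrier := H\<rparr>) x = labs K x"
proof -
  have sub: "subgroup H K" using H by (simp add: l_subgroup_def)
  then have "inv\<^bsub>K\<lparr>carrier := H\<rparr>\<^esub> x = inv x" using x by (rule m_inv_consistent)
  then show ?thesis
    using H x subgroup.m_inv_closed[OF sub x] by (simp add: labs_def sub_ljoin)
qed

text \<open>The meet of two comparable elements is one of them. This turns disjointness in a totally
  ordered factor into triviality of one side.\<close>

lemma lmeet_eq_one_total:
  assumes "x \<in> carrier K" "y \<in> carrier K"
    and total: "labs K x \<preceq> labs K y \<or> labs K y \<preceq> labs K x"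
  shows "labs K x \<^bold>\<and> labs K y = \<one> \<longleftrightarrow> x = \<one> \<or> y = \<one>"
  using total
proof
  assume "labs K x \<preceq> labs K y"
  moreover have "x = \<one>" if "y = \<one>" "labs K x \<preceq> labs K y"
    using that assms lle_antisym[of "labs K x" \<one>] by (simp add: labs_eq_one_iff)
  ultimately show ?thesis
    using assms by (auto simp: lmeet_absorb labs_eq_one_iff)
next
  assume "labs K y \<preceq> labs K x"
  moreover have "y = \<one>" if "x = \<one>" "labs K y \<preceq> labs K x"
    using that assms lle_antisym[of "labs K y" \<one>] by (simp add: labs_eq_one_iff)
  ultimately show ?thesis
    using assms by (auto simp: lmeet_absorb lmeet_commute[of "labs K x"] labs_eq_one_iff)
qed

end


section \<open>Products with the coordinatewise order\<close>

lemma product_lgroup_simps [simp]: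
  "carrier (product_lgroup I L) = (\<Pi>\<^sub>E i\<in>I. carrier (L i))"
  "x \<otimes>\<^bsub>product_lgroup I L\<^esub> y = (\<lambda>i\<in>I. x i \<otimes>\<^bsub>L i\<^esub> y i)"
  "\<one>\<^bsub>product_lgroup I L\<^esub> = (\<lambda>i\<in>I. \<one>\<^bsub>L i\<^esub>)"
  "x \<preceq>\<^bsub>product_lgroup I L\<^esub> y \<longleftrightarrow> (\<forall>i\<in>I. x i \<preceq>\<^bsub>L i\<^esub> y i)"
  by (simp_all add: product_lgroup_def monoid.defs lgroup.defs)

locale lgroup_family =
  fixes I :: "'i set" and L :: "'i \<Rightarrow> ('a, 'b) lgroup_scheme"
  assumes factor: "i \<in> I \<Longrightarrow> abelian_lgroup (L i)"
begin

lemma factor_comm_group: "i \<in> I \<Longrightarrow> comm_group (L i)"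
  by (rule abelian_lgroup.axioms(1)[OF factor])

lemma factor_group: "i \<in> I \<Longrightarrow> group (L i)"
  by (rule comm_group.axioms(2)[OF factor_comm_group])

lemma product_comm_group: "comm_group (product_lgroup I L)"
proof (rule comm_group_cong)
  show "comm_group (product_group I L)"
  proof (rule group.group_comm_groupI)
    show "group (product_group I L)" using factor_group by simp
    fix x y assume "x \<in> carrier (product_group I L)" "y \<in> carrier (product_group I L)"
    then show "x \<otimes>\<^bsub>product_group I L\<^esub> y = y \<otimes>\<^bsub>product_group I L\<^esub> x"
      using comm_monoid.m_comm[OF comm_group.axioms(1)[OF factor_comm_group]]
      by (auto simp: PiE_iff intro!: restrict_ext)
  qed
qed (simp_all add: fun_eq_iff)

lemma product_abelian_lgroup: "abelian_lgroup (product_lgroup I L)"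
proof (rule abelian_lgroupI)
  show "\<exists>s\<in>carrier (product_lgroup I L). x \<preceq>\<^bsub>product_lgroup I L\<^esub> s \<and> y \<preceq>\<^bsub>product_lgroup I L\<^esub> s \<and>
      (\<forall>z\<in>carrier (product_lgroup I L). x \<preceq>\<^bsub>product_lgroup I L\<^esub> z \<and> y \<preceq>\<^bsub>product_lgroup I L\<^esub> z \<longrightarrow>
        s \<preceq>\<^bsub>product_lgroup I L\<^esub> z)"
    if "x \<in> carrier (product_lgroup I L)" "y \<in> carrier (product_lgroup I L)" for x y
    using that factor
    by (intro bexI[of _ "\<lambda>i\<in>I. x i \<^bold>\<or>\<^bsub>L i\<^esub> y i"])
      (simp_all add: PiE_iff abelian_lgroup.ljoin_upper1 abelian_lgroup.ljoin_upper2
        abelian_lgroup.ljoin_least abelian_lgroup.ljoin_closed)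
  show "x = y" if "x \<in> carrier (product_lgroup I L)" "y \<in> carrier (product_lgroup I L)"
    "x \<preceq>\<^bsub>product_lgroup I L\<^esub> y" "y \<preceq>\<^bsub>product_lgroup I L\<^esub> x" for x y
    using that abelian_lgroup.lle_antisym[OF factor] by (auto simp: PiE_iff intro!: extensionalityI)
  show "x \<preceq>\<^bsub>product_lgroup I L\<^esub> z"
    if "x \<in> carrier (product_lgroup I L)" "y \<in> carrier (product_lgroup I L)" "z \<in> carrier (product_lgroup I L)"
      "x \<preceq>\<^bsub>product_lgroup I L\<^esub> y" "y \<preceq>\<^bsub>product_lgroup I L\<^esub> z" for x y z
    unfolding product_lgroup_simps
  proof
    fix i assume "i \<in> I"
    then show "x i \<preceq>\<^bsub>L i\<^esub> z i"
      using that abelian_lgroup.lle_trans[OF factor, of i "x i" "y i" "z i"] by (simp add: PiE_iff)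
  qed
  show "x \<otimes>\<^bsub>product_lgroup I L\<^esub> z \<preceq>\<^bsub>product_lgroup I L\<^esub> y \<otimes>\<^bsub>product_lgroup I L\<^esub> z"
    if "x \<in> carrier (product_lgroup I L)" "y \<in> carrier (product_lgroup I L)" "z \<in> carrier (product_lgroup I L)"
      "x \<preceq>\<^bsub>product_lgroup I L\<^esub> y" for x y z
    using that factor by (simp add: PiE_iff abelian_lgroup.mult_mono)
  show "x \<preceq>\<^bsub>product_lgroup I L\<^esub> x" if "x \<in> carrier (product_lgroup I L)" for x
    using that factor by (simp add: PiE_iff abelian_lgroup.lle_refl)
qed (rule product_comm_group)

lemma product_ljoin:
  assumes "x \<in> carrier (product_lgroup I L)" "y \<in> carrier (product_lgroup I L)"
  shows "x \<^bold>\<or>\<^bsub>product_lgroup I L\<^esub> y = (\<lambda>i\<in>I. x i \<^bold>\<or>\<^bsub>L i\<^esub> y i)"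
  by (rule abelian_lgroup.ljoin_eqI[OF product_abelian_lgroup])
    (use assms factor in \<open>simp_all add: PiE_iff abelian_lgroup.ljoin_upper1 abelian_lgroup.ljoin_upper2
        abelian_lgroup.ljoin_least abelian_lgroup.ljoin_closed\<close>)

lemma product_lmeet:
  assumes "x \<in> carrier (product_lgroup I L)" "y \<in> carrier (product_lgroup I L)"
  shows "x \<^bold>\<and>\<^bsub>product_lgroup I L\<^esub> y = (\<lambda>i\<in>I. x i \<^bold>\<and>\<^bsub>L i\<^esub> y i)"
  by (rule abelian_lgroup.lmeet_eqI[OF product_abelian_lgroup])
    (use assms factor in \<open>simp_all add: PiE_iff abelian_lgroup.lmeet_lower1 abelian_lgroup.lmeet_lower2
        abelian_lgroup.lmeet_greatest abelian_lgroup.lmeet_closed\<close>)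

lemma product_inv:
  assumes "x \<in> carrier (product_lgroup I L)"
  shows "inv\<^bsub>product_lgroup I L\<^esub> x = (\<lambda>i\<in>I. inv\<^bsub>L i\<^esub> x i)"
proof -
  have "inv\<^bsub>product_lgroup I L\<^esub> x = inv\<^bsub>product_group I L\<^esub> x"
    by (rule m_inv_cong) (simp_all add: fun_eq_iff)
  then show ?thesis using assms factor_group by simp
qed

lemma product_labs:
  assumes "x \<in> carrier (product_lgroup I L)"
  shows "labs (product_lgroup I L) x = (\<lambda>i\<in>I. labs (L i) (x i))"
proof -
  have "(\<lambda>i\<in>I. inv\<^bsub>L i\<^esub> x i) \<in> carrier (product_lgroup I L)"
    using assms group.inv_closed[OF factor_group] by (simp add: PiE_iff)
  then show ?thesis
    using assms unfolding labs_def product_inv[OF assms]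
    by (subst product_ljoin) (auto simp: labs_def intro!: restrict_ext)
qed

lemma product_pow:
  "x [^]\<^bsub>product_lgroup I L\<^esub> (n::nat) = (\<lambda>i\<in>I. x i [^]\<^bsub>L i\<^esub> n)"
  by (induction n) (auto simp: nat_pow_def intro!: restrict_ext)

end

section \<open>Quotients by convex subgroups\<close>

lemma quot_lgroup_simps [simp]:
  "carrier (quot_lgroup K p) = carrier (K Mod p)"
  "monoid.mult (quot_lgroup K p) = monoid.mult (K Mod p)"
  "one (quot_lgroup K p) = p"
  "X \<preceq>\<^bsub>quot_lgroup K p\<^esub> Y \<longleftrightarrow> (\<exists>x\<in>X. \<exists>y\<in>Y. x \<preceq>\<^bsub>K\<^esub> y)"
  by (simp_all add: quot_lgroup_def monoid.defs lgroup.defs FactGroup_def)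

text \<open>Convexity of \<open>p\<close> makes the order on cosets antisymmetric. Primeness enters
  in \<open>quot_total\<close>, where the quotient becomes a chain.\<close>

locale convex_quotient = abelian_lgroup K for K (structure) +
  fixes p
  assumes convex: "convex_l_subgroup p K"
begin

sublocale p: normal p K
  by (rule subgroup_imp_normal[OF convex_subgroup[OF convex]])

lemma coset_eq_iff:
  assumes "x \<in> carrier K" "y \<in> carrier K"
  shows "p #> x = p #> y \<longleftrightarrow> x \<otimes> inv y \<in> p"
proof
  assume "p #> x = p #> y"
  then have "x \<in> p #> y" using rcos_self[OF assms(1) p.subgroup_axioms] by simp
  then show "x \<otimes> inv y \<in> p" using assms p.rcos_module_imp[OF is_group] by blast
next
  assume "x \<otimes> inv y \<in> p"
  then have "x \<in> p #> y" using assms p.rcos_module_rev[OF is_group] by blast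
  then show "p #> x = p #> y"
    using repr_independence[OF _ assms(2) p.subgroup_axioms] by metis
qed

lemma coset_eq_self_iff: "x \<in> carrier K \<Longrightarrow> p #> x = p \<longleftrightarrow> x \<in> p"
  using coset_eq_iff[of x \<one>] p.subset by simp

lemma coset_carrier: "x \<in> carrier K \<Longrightarrow> p #> x \<in> carrier (quot_lgroup K p)"
  by (simp add: carrier_FactGroup)

lemma quot_carrierE:
  assumes "X \<in> carrier (quot_lgroup K p)"
  obtains x where "x \<in> carrier K" "X = p #> x"
  using assms by (auto simp: carrier_FactGroup)

lemma quot_mult:
  "\<lbrakk>x \<in> carrier K; y \<in> carrier K\<rbrakk> \<Longrightarrow> (p #> x) \<otimes>\<^bsub>quot_lgroup K p\<^esub> (p #> y) = p #> (x \<otimes> y)"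
  by (simp add: p.rcos_sum)

text \<open>The factors \<open>u\<close> and \<open>v\<close> that move the two representatives
  combine into the single element \<open>v \<otimes> inv u\<close> of \<open>p\<close>.\<close>

lemma quot_le_iff:
  assumes x: "x \<in> carrier K" and y: "y \<in> carrier K"
  shows "p #> x \<preceq>\<^bsub>quot_lgroup K p\<^esub> p #> y \<longleftrightarrow> (\<exists>w\<in>p. x \<preceq> w \<otimes> y)"
proof
  assume "p #> x \<preceq>\<^bsub>quot_lgroup K p\<^esub> p #> y"
  then obtain u v where uv: "u \<in> p" "v \<in> p" "u \<otimes> x \<preceq> v \<otimes> y"
    by (auto simp: r_coset_def)
  then have c: "u \<in> carrier K" "v \<in> carrier K" by auto
  have "x \<preceq> (v \<otimes> y) \<otimes> inv u" using uv(3) c x y mult_le_iff[of "v \<otimes> y" u x] by (simp add: m_comm)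
  then have "x \<preceq> (v \<otimes> inv u) \<otimes> y" using c x y by (simp add: m_ac)
  with uv show "\<exists>w\<in>p. x \<preceq> w \<otimes> y" by blast
next
  assume "\<exists>w\<in>p. x \<preceq> w \<otimes> y"
  then obtain w where "w \<in> p" "x \<preceq> w \<otimes> y" by blast
  moreover have "x \<in> p #> x" using x p.subgroup_axioms by (rule rcos_self)
  moreover have "w \<otimes> y \<in> p #> y" if "w \<in> p" for w using that y p.subset by (intro rcosI)
  ultimately show "p #> x \<preceq>\<^bsub>quot_lgroup K p\<^esub> p #> y" by auto
qed

lemma quot_le:
  assumes "x \<preceq> y" "x \<in> carrier K" "y \<in> carrier K"
  shows "p #> x \<preceq>\<^bsub>quot_lgroup K p\<^esub> p #> y"
  unfolding quot_le_iff[OF assms(2,3)] using assms by (intro bexI[of _ \<one>]) auto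

lemma quot_le_trans:
  assumes "x \<in> carrier K" "y \<in> carrier K" "z \<in> carrier K"
    and "p #> x \<preceq>\<^bsub>quot_lgroup K p\<^esub> p #> y" "p #> y \<preceq>\<^bsub>quot_lgroup K p\<^esub> p #> z"
  shows "p #> x \<preceq>\<^bsub>quot_lgroup K p\<^esub> p #> z"
proof -
  obtain u v where uv: "u \<in> p" "v \<in> p" "x \<preceq> u \<otimes> y" "y \<preceq> v \<otimes> z"
    using assms by (auto simp only: quot_le_iff)
  then have c: "u \<in> carrier K" "v \<in> carrier K" by auto
  have "x \<preceq> u \<otimes> y" by fact
  also have "u \<otimes> y \<preceq> u \<otimes> (v \<otimes> z)" using uv c assms(1-3) by (intro mult_mono2) simp_all
  finally have "x \<preceq> (u \<otimes> v) \<otimes> z" using c assms(1-3) by (simp add: m_assoc)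
  with uv show ?thesis unfolding quot_le_iff[OF assms(1,3)] by blast
qed

text \<open>The two inequalities trap \<open>x \<otimes> inv y\<close> between \<open>inv v\<close>
  and \<open>u\<close>, both in \<open>p\<close>, and convexity applies.\<close>

lemma quot_le_antisym:
  assumes x: "x \<in> carrier K" and y: "y \<in> carrier K"
    and "p #> x \<preceq>\<^bsub>quot_lgroup K p\<^esub> p #> y" "p #> y \<preceq>\<^bsub>quot_lgroup K p\<^esub> p #> x"
  shows "p #> x = p #> y"
proof -
  obtain u v where uv: "u \<in> p" "v \<in> p" "x \<preceq> u \<otimes> y" "y \<preceq> v \<otimes> x"
    using assms by (auto simp only: quot_le_iff)
  then have c: "u \<in> carrier K" "v \<in> carrier K" by auto
  have "x \<otimes> inv y \<preceq> u" using uv c x y by (simp add: le_mult_iff)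
  moreover have "inv v \<preceq> x \<otimes> inv y"
    using uv c x y inv_antimono[of "y \<otimes> inv x" v] by (simp add: le_mult_iff inv_mult m_comm)
  ultimately have "x \<otimes> inv y \<in> p"
    using convex uv x y p.m_inv_closed[of v] unfolding convex_l_subgroup_def by blast
  then show ?thesis using x y by (simp add: coset_eq_iff)
qed

text \<open>The join of the two correcting factors works for both inequalities at once, and it lies
  in \<open>p\<close> because \<open>p\<close> is a sublattice.\<close>

lemma quot_le_join:
  assumes x: "x \<in> carrier K" and y: "y \<in> carrier K" and z: "z \<in> carrier K"
    and "p #> x \<preceq>\<^bsub>quot_lgroup K p\<^esub> p #> z" "p #> y \<preceq>\<^bsub>quot_lgroup K p\<^esub> p #> z"
  shows "p #> (x \<^bold>\<or> y) \<preceq>\<^bsub>quot_lgroup K p\<^esub> p #> z"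
proof -
  obtain u v where uv: "u \<in> p" "v \<in> p" "x \<preceq> u \<otimes> z" "y \<preceq> v \<otimes> z"
    using assms by (auto simp only: quot_le_iff)
  then have c: "u \<in> carrier K" "v \<in> carrier K" by auto
  have "x \<preceq> (u \<^bold>\<or> v) \<otimes> z" "y \<preceq> (u \<^bold>\<or> v) \<otimes> z"
    using uv c x y z mult_mono[of u "u \<^bold>\<or> v" z] mult_mono[of v "u \<^bold>\<or> v" z]
      lle_trans[of x "u \<otimes> z" "(u \<^bold>\<or> v) \<otimes> z"] lle_trans[of y "v \<otimes> z" "(u \<^bold>\<or> v) \<otimes> z"] by simp_all
  then have "x \<^bold>\<or> y \<preceq> (u \<^bold>\<or> v) \<otimes> z" using x y z c by (intro ljoin_least) simp_all
  moreover have "u \<^bold>\<or> v \<in> p" using convex uv(1,2) unfolding convex_l_subgroup_def l_subgroup_def by blast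
  ultimately show ?thesis unfolding quot_le_iff[OF ljoin_closed[OF x y] z] by blast
qed

lemma quot_comm_group: "comm_group (quot_lgroup K p)"
  by (rule comm_group_cong[OF abelian_FactGroup[OF p.subgroup_axioms]]) simp_all

lemma quot_abelian_lgroup: "abelian_lgroup (quot_lgroup K p)"
proof (rule abelian_lgroupI)
  note [simp del] = quot_lgroup_simps
  let ?Q = "quot_lgroup K p"
  show "comm_group ?Q" by (rule quot_comm_group)
  show "X \<preceq>\<^bsub>?Q\<^esub> X" if "X \<in> carrier ?Q" for X
    using that by (auto elim!: quot_carrierE intro: quot_le)
  show "X = Y" if "X \<in> carrier ?Q" "Y \<in> carrier ?Q" "X \<preceq>\<^bsub>?Q\<^esub> Y" "Y \<preceq>\<^bsub>?Q\<^esub> X" for X Y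
    using that by (elim quot_carrierE) (metis quot_le_antisym)
  show "X \<preceq>\<^bsub>?Q\<^esub> Z"
    if "X \<in> carrier ?Q" "Y \<in> carrier ?Q" "Z \<in> carrier ?Q" "X \<preceq>\<^bsub>?Q\<^esub> Y" "Y \<preceq>\<^bsub>?Q\<^esub> Z" for X Y Z
    using that by (elim quot_carrierE) (metis quot_le_trans)
  show "X \<otimes>\<^bsub>?Q\<^esub> Z \<preceq>\<^bsub>?Q\<^esub> Y \<otimes>\<^bsub>?Q\<^esub> Z"
    if XYZ: "X \<in> carrier ?Q" "Y \<in> carrier ?Q" "Z \<in> carrier ?Q" and le: "X \<preceq>\<^bsub>?Q\<^esub> Y" for X Y Z
  proof -
    obtain x where x: "x \<in> carrier K" "X = p #> x" using XYZ(1) by (rule quot_carrierE)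
    obtain y where y: "y \<in> carrier K" "Y = p #> y" using XYZ(2) by (rule quot_carrierE)
    obtain z where z: "z \<in> carrier K" "Z = p #> z" using XYZ(3) by (rule quot_carrierE)
    obtain w where w: "w \<in> p" "x \<preceq> w \<otimes> y" using le x y by (auto simp: quot_le_iff)
    then have "x \<otimes> z \<preceq> w \<otimes> (y \<otimes> z)"
      using mult_mono[of x "w \<otimes> y" z] x y z by (simp add: m_assoc)
    then show ?thesis using x y z w by (auto simp: quot_mult quot_le_iff)
  qed
  show "\<exists>S\<in>carrier ?Q. X \<preceq>\<^bsub>?Q\<^esub> S \<and> Y \<preceq>\<^bsub>?Q\<^esub> S \<and> (\<forall>Z\<in>carrier ?Q. X \<preceq>\<^bsub>?Q\<^esub> Z \<and> Y \<preceq>\<^bsub>?Q\<^esub> Z \<longrightarrow> S \<preceq>\<^bsub>?Q\<^esub> Z)"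
    if XY: "X \<in> carrier ?Q" "Y \<in> carrier ?Q" for X Y
  proof -
    obtain x where x: "x \<in> carrier K" "X = p #> x" using XY(1) by (rule quot_carrierE)
    obtain y where y: "y \<in> carrier K" "Y = p #> y" using XY(2) by (rule quot_carrierE)
    show ?thesis
      using x y
      by (intro bexI[of _ "p #> (x \<^bold>\<or> y)"])
        (auto simp: coset_carrier elim!: quot_carrierE intro: quot_le quot_le_join)
  qed
qed

lemma quot_ljoin:
  assumes "x \<in> carrier K" "y \<in> carrier K"
  shows "(p #> x) \<^bold>\<or>\<^bsub>quot_lgroup K p\<^esub> (p #> y) = p #> (x \<^bold>\<or> y)"
proof (rule abelian_lgroup.ljoin_eqI[OF quot_abelian_lgroup])
  note [simp del] = quot_lgroup_simps
  show "p #> (x \<^bold>\<or> y) \<preceq>\<^bsub>quot_lgroup K p\<^esub> Z" if "Z \<in> carrier (quot_lgroup K p)"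
    "p #> x \<preceq>\<^bsub>quot_lgroup K p\<^esub> Z" "p #> y \<preceq>\<^bsub>quot_lgroup K p\<^esub> Z" for Z
    using that assms by (auto elim!: quot_carrierE intro: quot_le_join)
  show "p #> x \<in> carrier (quot_lgroup K p)" "p #> y \<in> carrier (quot_lgroup K p)"
    "p #> (x \<^bold>\<or> y) \<in> carrier (quot_lgroup K p)"
    "p #> x \<preceq>\<^bsub>quot_lgroup K p\<^esub> p #> (x \<^bold>\<or> y)" "p #> y \<preceq>\<^bsub>quot_lgroup K p\<^esub> p #> (x \<^bold>\<or> y)"
    using assms by (auto intro: coset_carrier quot_le)
qed

lemma quot_inv:
  assumes "x \<in> carrier K"
  shows "inv\<^bsub>quot_lgroup K p\<^esub> (p #> x) = p #> inv x"
proof (rule group.inv_equality)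
  show "group (quot_lgroup K p)" by (rule comm_group.axioms(2)[OF quot_comm_group])
  show "(p #> inv x) \<otimes>\<^bsub>quot_lgroup K p\<^esub> (p #> x) = \<one>\<^bsub>quot_lgroup K p\<^esub>"
    using assms by (simp add: p.rcos_sum p.subset)
qed (use assms coset_carrier in auto)

lemma quot_lmeet:
  assumes "x \<in> carrier K" "y \<in> carrier K"
  shows "(p #> x) \<^bold>\<and>\<^bsub>quot_lgroup K p\<^esub> (p #> y) = p #> (x \<^bold>\<and> y)"
  using assms coset_carrier
  by (simp add: abelian_lgroup.lmeet_eq_inv_ljoin[OF quot_abelian_lgroup] lmeet_eq_inv_ljoin
      quot_ljoin quot_inv del: quot_lgroup_simps)

lemma quot_labs:
  "x \<in> carrier K \<Longrightarrow> labs (quot_lgroup K p) (p #> x) = p #> labs K x"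
  by (simp add: labs_def quot_inv quot_ljoin)

lemma quot_pow:
  assumes "x \<in> carrier K"
  shows "(p #> x) [^]\<^bsub>quot_lgroup K p\<^esub> (n::nat) = p #> (x [^] n)"
proof -
  have "(p #> x) [^]\<^bsub>quot_lgroup K p\<^esub> n = (p #> x) [^]\<^bsub>K Mod p\<^esub> n"
    by (rule nat_pow_cong) simp_all
  then show ?thesis using p.FactGroup_pow[OF assms] by simp
qed

end

text \<open>Divided by their meet, \<open>x\<close> and \<open>y\<close> become disjoint, so one of
  the results lies in \<open>p\<close>. The coset of that element is then the coset of the meet,
  which is below the other coset.\<close>

lemma (in abelian_lgroup) quot_total:
  assumes p: "p \<in> Spec_lgroup K" and X: "X \<in> carrier (quot_lgroup K p)" and Y: "Y \<in> carrier (quot_lgroup K p)"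
  shows "X \<preceq>\<^bsub>quot_lgroup K p\<^esub> Y \<or> Y \<preceq>\<^bsub>quot_lgroup K p\<^esub> X"
proof -
  interpret convex_quotient K p
    by unfold_locales (rule Spec_convex[OF p])
  obtain x where x: "x \<in> carrier K" "X = p #> x" using X by (rule quot_carrierE)
  obtain y where y: "y \<in> carrier K" "Y = p #> y" using Y by (rule quot_carrierE)
  let ?m = "x \<^bold>\<and> y"
  have m: "?m \<in> carrier K" using x y by simp
  have "(x \<otimes> inv ?m) \<^bold>\<and> (y \<otimes> inv ?m) = \<one>" using x y by (simp flip: lmeet_mult)
  then have "x \<otimes> inv ?m \<in> p \<or> y \<otimes> inv ?m \<in> p"
    using p x y by (simp add: Spec_lgroup_def)
  then have "p #> x = p #> ?m \<or> p #> y = p #> ?m" using x y m by (simp add: coset_eq_iff)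
  then show ?thesis using x y m quot_le[of ?m x] quot_le[of ?m y] by auto
qed


section \<open>Density in the patch topology\<close>

context abelian_lgroup
begin

text \<open>Together with \<open>mult_labs_mem_iff\<close> this encodes a disjunction or conjunction
  of memberships in a single element, so that basic patch sets are closed under intersection.
  Primeness gives one direction, convexity the other.\<close>

lemma lmeet_labs_mem_iff:
  assumes p: "p \<in> Spec_lgroup K" and x: "x \<in> carrier K" and y: "y \<in> carrier K"
  shows "labs K x \<^bold>\<and> labs K y \<in> p \<longleftrightarrow> x \<in> p \<or> y \<in> p"
proof
  assume "labs K x \<^bold>\<and> labs K y \<in> p"
  then have "labs K x \<in> p \<or> labs K y \<in> p" using x y by (intro Spec_prime[OF p]) auto
  then show "x \<in> p \<or> y \<in> p" using convex_labs_iff[OF Spec_convex[OF p]] x y by blast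
next
  have pos: "\<one> \<preceq> labs K x \<^bold>\<and> labs K y" using x y by (intro lmeet_greatest) simp_all
  assume "x \<in> p \<or> y \<in> p"
  then have "labs K x \<in> p \<or> labs K y \<in> p" using convex_labs_iff[OF Spec_convex[OF p]] x y by blast
  then show "labs K x \<^bold>\<and> labs K y \<in> p"
  proof
    assume "labs K x \<in> p"
    from convex_le[OF Spec_convex[OF p] this pos] show ?thesis using x y by simp
  next
    assume "labs K y \<in> p"
    from convex_le[OF Spec_convex[OF p] this pos] show ?thesis using x y by simp
  qed
qed

lemma mult_labs_mem_iff:
  assumes p: "convex_l_subgroup p K" and x: "x \<in> carrier K" and y: "y \<in> carrier K"
  shows "labs K x \<otimes> labs K y \<in> p \<longleftrightarrow> x \<in> p \<and> y \<in> p"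
proof
  assume *: "labs K x \<otimes> labs K y \<in> p"
  have "labs K x \<preceq> labs K x \<otimes> labs K y" using x y by (intro le_mult_right) simp_all
  moreover have "labs K y \<preceq> labs K x \<otimes> labs K y"
    using x y le_mult_right[of "labs K y" "labs K y" "labs K x"] by (simp add: m_comm)
  ultimately have "labs K x \<in> p" "labs K y \<in> p"
    using convex_le[OF p *, of "labs K x"] convex_le[OF p *, of "labs K y"] x y by simp_all
  then show "x \<in> p \<and> y \<in> p" using convex_labs_iff[OF p] x y by simp
next
  assume "x \<in> p \<and> y \<in> p"
  then show "labs K x \<otimes> labs K y \<in> p" using convex_labs_iff[OF p] x y convex_mult_closed[OF p] by simp
qed

section \<open>The patch topology and dense sets of primes\<close>

definition patch_basic :: "'a \<Rightarrow> 'a \<Rightarrow> 'a set set" where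
  "patch_basic a b = {p \<in> Spec_lgroup K. a \<notin> p \<and> b \<in> p}"

lemma patch_topology_eq:
  "patch_topology K = topology_generated_by {patch_basic a b |a b. a \<in> carrier K \<and> b \<in> carrier K}"
  by (simp add: patch_topology_def patch_basic_def)

lemma patch_basic_Int:
  assumes "a \<in> carrier K" "b \<in> carrier K" "a' \<in> carrier K" "b' \<in> carrier K"
  shows "patch_basic a b \<inter> patch_basic a' b' =
    patch_basic (labs K a \<^bold>\<and> labs K a') (labs K b \<otimes> labs K b')"
  using assms by (auto simp: patch_basic_def lmeet_labs_mem_iff mult_labs_mem_iff[OF Spec_convex])

lemma openin_patch_basic:
  "\<lbrakk>a \<in> carrier K; b \<in> carrier K\<rbrakk> \<Longrightarrow> openin (patch_topology K) (patch_basic a b)"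
  unfolding patch_topology_eq by (rule topology_generated_by_Basis) blast

text \<open>A prime is proper, so it omits some \<open>a\<close>; with \<open>b = \<one>\<close> it
  lies in a basic set.\<close>

lemma topspace_patch_topology: "topspace (patch_topology K) = Spec_lgroup K"
proof -
  have "\<exists>a b. a \<in> carrier K \<and> b \<in> carrier K \<and> p \<in> patch_basic a b" if p: "p \<in> Spec_lgroup K" for p
  proof -
    have "\<exists>a\<in>carrier K. a \<notin> p"
      using p convex_mem_carrier[OF Spec_convex[OF p]] by (auto simp: Spec_lgroup_def)
    then show ?thesis
      using p convex_one_closed[OF Spec_convex[OF p]] by (auto simp: patch_basic_def)
  qed
  then have "Spec_lgroup K \<subseteq> \<Union>{patch_basic a b |a b. a \<in> carrier K \<and> b \<in> carrier K}" by blast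
  moreover have "\<Union>{patch_basic a b |a b. a \<in> carrier K \<and> b \<in> carrier K} \<subseteq> Spec_lgroup K"
    by (auto simp: patch_basic_def)
  ultimately show ?thesis
    unfolding patch_topology_eq topology_generated_by_topspace by (rule subset_antisym[rotated])
qed

text \<open>The topology is generated from the basic sets as a subbase. By
  \<open>patch_basic_Int\<close> they already form a base, which the induction over the generation
  of \<open>U\<close> uses in the intersection case.\<close>

lemma openin_patch_topologyD:
  assumes "openin (patch_topology K) U" "q \<in> U"
  shows "\<exists>a\<in>carrier K. \<exists>b\<in>carrier K. q \<in> patch_basic a b \<and> patch_basic a b \<subseteq> U"
proof -
  have "generate_topology_on {patch_basic a b |a b. a \<in> carrier K \<and> b \<in> carrier K} U"
    using assms(1) by (simp add: patch_topology_eq openin_topology_generated_by_iff)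
  then show ?thesis using assms(2)
  proof (induction arbitrary: q)
    case (Int U V)
    obtain a b where ab: "a \<in> carrier K" "b \<in> carrier K" "q \<in> patch_basic a b" "patch_basic a b \<subseteq> U"
      using Int.IH(1)[of q] Int.prems by blast
    obtain a' b' where ab': "a' \<in> carrier K" "b' \<in> carrier K" "q \<in> patch_basic a' b'" "patch_basic a' b' \<subseteq> V"
      using Int.IH(2)[of q] Int.prems by blast
    show ?case
      using ab ab' patch_basic_Int[OF ab(1,2) ab'(1,2)]
      by (intro bexI[of _ "labs K a \<^bold>\<and> labs K a'"] bexI[of _ "labs K b \<otimes> labs K b'"]) auto
  next
    case (UN \<U>)
    then obtain V where V: "V \<in> \<U>" "q \<in> V" by blast
    with UN.IH[OF V] show ?case by blast
  qed blast+
qed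

text \<open>The set \<open>patch_basic a b\<close> is nonempty exactly when \<open>a\<close> is
  outside the principal convex subgroup of \<open>b\<close>: prime separation gives a point, and a
  prime containing \<open>b\<close> contains that subgroup. Density means that \<open>P\<close>
  meets every nonempty basic set.\<close>

lemma dense_patch_iff:
  assumes "P \<subseteq> Spec_lgroup K"
  shows "dense_subset (patch_topology K) P \<longleftrightarrow>
    (\<forall>b\<in>carrier K. \<forall>a\<in>carrier K. (\<forall>p\<in>P. b \<in> p \<longrightarrow> a \<in> p) \<longrightarrow> a \<in> principal_convex K b)"
proof (intro iffI ballI impI)
  fix b a
  assume dense: "dense_subset (patch_topology K) P" and b: "b \<in> carrier K" and a: "a \<in> carrier K"
    and sub: "\<forall>p\<in>P. b \<in> p \<longrightarrow> a \<in> p"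
  show "a \<in> principal_convex K b"
  proof (rule ccontr)
    assume "a \<notin> principal_convex K b"
    then obtain q where q: "q \<in> Spec_lgroup K" "principal_convex K b \<subseteq> q" "a \<notin> q"
      using prime_separation[OF principal_convex_convex[OF b] a] by blast
    then have "q \<in> patch_basic a b" using mem_principal_convex[OF b] by (auto simp: patch_basic_def)
    moreover have "q \<in> patch_topology K closure_of P"
      using dense q(1) by (simp add: dense_subset_def topspace_patch_topology)
    ultimately obtain p where "p \<in> P" "p \<in> patch_basic a b"
      using openin_patch_basic[OF a b] unfolding in_closure_of by blast
    then show False using sub by (auto simp: patch_basic_def)
  qed
next
  assume D: "\<forall>b\<in>carrier K. \<forall>a\<in>carrier K. (\<forall>p\<in>P. b \<in> p \<longrightarrow> a \<in> p) \<longrightarrow> a \<in> principal_convex K b"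
  have "q \<in> patch_topology K closure_of P" if q: "q \<in> Spec_lgroup K" for q
    unfolding in_closure_of
  proof (intro conjI allI impI)
    show "q \<in> topspace (patch_topology K)" using q by (simp add: topspace_patch_topology)
    fix U assume U: "q \<in> U \<and> openin (patch_topology K) U"
    obtain a b where ab: "a \<in> carrier K" "b \<in> carrier K" "q \<in> patch_basic a b" "patch_basic a b \<subseteq> U"
      using openin_patch_topologyD[of U q] U by blast
    then have "a \<notin> principal_convex K b"
      using principal_convex_subset[OF Spec_convex[OF q], of b] by (auto simp: patch_basic_def)
    then obtain p where "p \<in> P" "b \<in> p" "a \<notin> p" using D ab(1,2) by blast
    then show "\<exists>p. p \<in> P \<and> p \<in> U" using ab(4) assms by (auto simp: patch_basic_def)
  qed
  then show "dense_subset (patch_topology K) P"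
    using assms closure_of_subset_topspace[of "patch_topology K" P]
    by (auto simp: dense_subset_def topspace_patch_topology)
qed

text \<open>Adjoining \<open>u\<close> to the maximal \<open>m\<close> yields the whole group. The
  resulting bound is the archimedean property of the quotient by \<open>m\<close>, written in
  \<open>K\<close>.\<close>

lemma Max_bound:
  assumes m: "m \<in> Max_lgroup K" and u: "u \<in> carrier K" "u \<notin> m" and v: "v \<in> carrier K"
  obtains w n where "w \<in> m" "labs K v \<preceq> w \<otimes> labs K u [^] (n::nat)"
proof -
  have c: "convex_l_subgroup m K" using m by (simp add: Max_lgroup_def)
  have "convex_adjoin m u \<noteq> m" using mem_convex_adjoin[OF c u(1)] u by blast
  then have "convex_adjoin m u = carrier K"
    using m convex_adjoin_convex[OF c u(1)] subset_convex_adjoin[OF c, of u]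
    unfolding Max_lgroup_def by blast
  then obtain h n where h: "h \<in> m" "labs K v \<preceq> labs K h \<otimes> labs K u [^] (n::nat)"
    using v unfolding convex_adjoin_def by blast
  moreover have "labs K h \<in> m" using h c convex_mem_carrier[OF c h(1)] by (simp add: convex_labs_iff)
  ultimately show thesis using that by blast
qed

lemma dense_patch_iff_class_Y:
  assumes "P \<subseteq> Spec_lgroup K" and PM: "P \<subseteq> Max_lgroup K"
  shows "dense_subset (patch_topology K) P \<longleftrightarrow>
    class_Y K \<and> dense_subset (subtopology (patch_topology K) (Max_lgroup K)) P"
proof
  assume dense: "dense_subset (patch_topology K) P"
  \<comment> \<open>The members of \<open>P\<close> containing \<open>a\<close> are the family of
    maximal subgroups required by (Y).\<close>
  have eq: "principal_convex K a = carrier K \<inter> \<Inter>{p \<in> P. a \<in> p}" if a: "a \<in> carrier K" for a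
  proof
    show "principal_convex K a \<subseteq> carrier K \<inter> \<Inter>{p \<in> P. a \<in> p}"
      using assms(1) principal_convex_subset[OF Spec_convex, of _ a]
      by (auto simp: principal_convex_def)
    show "carrier K \<inter> \<Inter>{p \<in> P. a \<in> p} \<subseteq> principal_convex K a"
      using dense a unfolding dense_patch_iff[OF assms(1)] by blast
  qed
  have "class_Y K"
    unfolding class_Y_def
  proof (intro ballI exI conjI)
    fix a assume "a \<in> carrier K"
    then show "principal_convex K a = carrier K \<inter> \<Inter>{p \<in> P. a \<in> p}" by (rule eq)
    show "{p \<in> P. a \<in> p} \<subseteq> Max_lgroup K" using PM by blast
  qed
  \<comment> \<open>Closure in a subspace is the trace of the closure in the whole space, so density
    is inherited.\<close>
  moreover have "dense_subset (subtopology (patch_topology K) (Max_lgroup K)) P"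
    using dense PM
    by (auto simp: dense_subset_def closure_of_subtopology inf.absorb2 topspace_subtopology)
  ultimately show "class_Y K \<and> dense_subset (subtopology (patch_topology K) (Max_lgroup K)) P" ..
next
  assume *: "class_Y K \<and> dense_subset (subtopology (patch_topology K) (Max_lgroup K)) P"
  show "dense_subset (patch_topology K) P"
    unfolding dense_patch_iff[OF assms(1)]
  proof (intro ballI impI)
    fix b a assume b: "b \<in> carrier K" and a: "a \<in> carrier K" and sub: "\<forall>p\<in>P. b \<in> p \<longrightarrow> a \<in> p"
    obtain A where A: "A \<subseteq> Max_lgroup K" "principal_convex K b = carrier K \<inter> \<Inter>A"
      using * b by (auto simp: class_Y_def)
    show "a \<in> principal_convex K b"
    proof (rule ccontr)
      assume "a \<notin> principal_convex K b"
      \<comment> \<open>Density is known only at points of \<open>Max_lgroup K\<close>. Here (Y)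
        supplies a maximal \<open>m\<close> in place of the prime that separation would
        give.\<close>
      then obtain m where m: "m \<in> A" "a \<notin> m" using A a by blast
      then have mM: "m \<in> Max_lgroup K" using A by blast
      then have mS: "m \<in> Spec_lgroup K" using Max_subset_Spec by blast
      have "b \<in> m" using mem_principal_convex[OF b] A m by blast
      then have "m \<in> patch_basic a b" using m mS by (simp add: patch_basic_def)
      moreover have "m \<in> patch_topology K closure_of P"
        using * mM mS PM
        by (auto simp: dense_subset_def closure_of_subtopology inf.absorb2 topspace_subtopology
            topspace_patch_topology)
      ultimately obtain p where "p \<in> P" "p \<in> patch_basic a b"
        using openin_patch_basic[OF a b] unfolding in_closure_of by blast
      then show False using sub by (auto simp: patch_basic_def)
    qed
  qed
qed

end


section \<open>The group \<open>G + B\<close>\<close>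

text \<open>For empty \<open>P\<close> the set \<open>\<Inter>P\<close> is the whole type.
  Intersecting with the carrier reads the empty intersection as \<open>G\<close>, which is then
  trivial.\<close>

locale G_plus_B_construction = abelian_lgroup G for G :: "('a, 'b) lgroup_scheme" (structure) +
  fixes P :: "'a set set"
  assumes P_Spec: "P \<subseteq> Spec_lgroup G"
    and P_Inter: "carrier G \<inter> \<Inter>P = {\<one>}"
begin

abbreviation I :: "('a set \<times> nat) set" where "I \<equiv> GPN_index P"
abbreviation L :: "'a set \<times> nat \<Rightarrow> 'a set lgroup" where "L \<equiv> GPN_factor G"

lemma index_prime: "i \<in> I \<Longrightarrow> fst i \<in> P"
  by (auto simp: GPN_index_def)

lemma index_Spec: "i \<in> I \<Longrightarrow> fst i \<in> Spec_lgroup G"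
  using index_prime P_Spec by blast

lemma factor_eq: "L i = quot_lgroup G (fst i)"
  by (cases i) (simp add: GPN_factor_def)

text \<open>The unit of a quotient by \<open>p\<close> is the coset \<open>p\<close> itself. Hence
  \<open>k i = fst i\<close> below says that \<open>k\<close> vanishes at the index
  \<open>i\<close>.\<close>

lemma one_factor [simp]: "\<one>\<^bsub>L i\<^esub> = fst i"
  by (simp add: factor_eq)

lemma quotient_locale: "i \<in> I \<Longrightarrow> convex_quotient G (fst i)"
  by unfold_locales (rule Spec_convex[OF index_Spec])

sublocale family: lgroup_family I L
  by (rule lgroup_family.intro)
    (simp only: factor_eq convex_quotient.quot_abelian_lgroup[OF quotient_locale])

lemma GPN_eq: "GPN G P = product_lgroup I L"
  by (simp add: GPN_def)

lemma factor_carrierE: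
  assumes "i \<in> I" "X \<in> carrier (L i)"
  obtains x where "x \<in> carrier G" "X = fst i #> x"
  using convex_quotient.quot_carrierE[OF quotient_locale] assms by (metis factor_eq)

lemma hat_apply: "i \<in> I \<Longrightarrow> hat G P g i = fst i #> g"
  by (cases i) (simp add: hat_def)

lemma hat_carrier:
  assumes "g \<in> carrier G"
  shows "hat G P g \<in> carrier (GPN G P)"
proof -
  have "hat G P g \<in> extensional I" by (simp add: hat_def)
  then show ?thesis
    using assms convex_quotient.coset_carrier[OF quotient_locale]
    by (simp add: GPN_eq PiE_iff hat_apply factor_eq del: quot_lgroup_simps)
qed

lemma hat_one: "i \<in> I \<Longrightarrow> hat G P \<one> i = fst i"
  using convex_quotient.coset_eq_self_iff[OF quotient_locale, of i \<one>]
    convex_one_closed[OF Spec_convex[OF index_Spec]]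
  by (simp add: hat_apply)

text \<open>This is the set of sums of some \<open>hat G P g\<close> and an element of
  \<open>B\<close>, phrased so that closure under the operations can be checked coordinate by
  coordinate.\<close>

definition almost_hat :: "('a set \<times> nat \<Rightarrow> 'a set) set" where
  "almost_hat = {k \<in> carrier (GPN G P). \<exists>g\<in>carrier G. finite {i \<in> I. k i \<noteq> hat G P g i}}"

lemma hat_almost_hat: "g \<in> carrier G \<Longrightarrow> hat G P g \<in> almost_hat"
  unfolding almost_hat_def using hat_carrier by (auto intro!: bexI[of _ g])

lemma almost_hatE:
  assumes "k \<in> almost_hat"
  obtains g where "g \<in> carrier G" "finite {i \<in> I. k i \<noteq> hat G P g i}"
  using assms by (auto simp: almost_hat_def)

lemma almost_hat_PiE: "k \<in> almost_hat \<Longrightarrow> k \<in> (\<Pi>\<^sub>E i\<in>I. carrier (L i))"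
  by (simp add: almost_hat_def GPN_eq)

text \<open>Outside the union of the two finite exceptional sets, \<open>m\<close> agrees with the
  image of \<open>f g h\<close>. One argument thus serves inverses, products, meets and
  joins.\<close>

lemma almost_hat_op:
  assumes k: "k \<in> almost_hat" and l: "l \<in> almost_hat" and m: "m \<in> carrier (GPN G P)"
    and op: "\<And>g h. \<lbrakk>g \<in> carrier G; h \<in> carrier G\<rbrakk> \<Longrightarrow> f g h \<in> carrier G"
    and eq: "\<And>i g h. \<lbrakk>i \<in> I; g \<in> carrier G; h \<in> carrier G; k i = fst i #> g; l i = fst i #> h\<rbrakk>
      \<Longrightarrow> m i = fst i #> f g h"
  shows "m \<in> almost_hat"
proof -
  obtain g where g: "g \<in> carrier G" "finite {i \<in> I. k i \<noteq> hat G P g i}" using k by (rule almost_hatE)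
  obtain h where h: "h \<in> carrier G" "finite {i \<in> I. l i \<noteq> hat G P h i}" using l by (rule almost_hatE)
  have "{i \<in> I. m i \<noteq> hat G P (f g h) i} \<subseteq> {i \<in> I. k i \<noteq> hat G P g i} \<union> {i \<in> I. l i \<noteq> hat G P h i}"
    using eq[OF _ g(1) h(1)] by (auto simp: hat_apply)
  then have "finite {i \<in> I. m i \<noteq> hat G P (f g h) i}"
    using g(2) h(2) by (meson finite_Un finite_subset)
  then show ?thesis using m op[OF g(1) h(1)] by (auto simp: almost_hat_def)
qed

lemma GPN_abelian: "abelian_lgroup (GPN G P)"
  unfolding GPN_eq by (rule family.product_abelian_lgroup)

lemma almost_hat_l_subgroup: "l_subgroup almost_hat (GPN G P)"
proof -
  interpret T: abelian_lgroup "GPN G P" by (rule GPN_abelian)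
  have car: "k \<in> carrier (GPN G P)" if "k \<in> almost_hat" for k
    using that by (simp add: almost_hat_def)
  have one: "\<one>\<^bsub>GPN G P\<^esub> = hat G P \<one>"
  proof (rule ext)
    fix i
    show "\<one>\<^bsub>GPN G P\<^esub> i = hat G P \<one> i"
      by (cases "i \<in> I") (simp_all add: GPN_eq hat_one, simp add: hat_def)
  qed
  have "subgroup almost_hat (GPN G P)"
  proof
    show "almost_hat \<subseteq> carrier (GPN G P)" using car by blast
    show "\<one>\<^bsub>GPN G P\<^esub> \<in> almost_hat"
      unfolding one by (rule hat_almost_hat) simp
    fix k assume k: "k \<in> almost_hat"
    show "inv\<^bsub>GPN G P\<^esub> k \<in> almost_hat"
    \<comment> \<open>Inversion is treated as a binary operation that ignores its second
      argument.\<close>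
    proof (rule almost_hat_op[OF k k, of _ "\<lambda>g h. inv g"])
      fix i g assume "i \<in> I" "g \<in> carrier G" "k i = fst i #> g"
      then show "(inv\<^bsub>GPN G P\<^esub> k) i = fst i #> inv g"
        using family.product_inv[of k] car[OF k] convex_quotient.quot_inv[OF quotient_locale, of i g]
        by (simp add: GPN_eq factor_eq)
    qed (use car[OF k] in simp_all)
    fix l assume l: "l \<in> almost_hat"
    show "k \<otimes>\<^bsub>GPN G P\<^esub> l \<in> almost_hat"
    proof (rule almost_hat_op[OF k l, of _ "\<lambda>g h. g \<otimes> h"])
      fix i g h assume "i \<in> I" "g \<in> carrier G" "h \<in> carrier G" "k i = fst i #> g" "l i = fst i #> h"
      then show "(k \<otimes>\<^bsub>GPN G P\<^esub> l) i = fst i #> (g \<otimes> h)"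
        using convex_quotient.quot_mult[OF quotient_locale, of i g h]
        by (simp add: GPN_eq factor_eq)
    qed (use car[OF k] car[OF l] in simp_all)
  qed
  moreover have "k \<^bold>\<and>\<^bsub>GPN G P\<^esub> l \<in> almost_hat" if k: "k \<in> almost_hat" and l: "l \<in> almost_hat" for k l
  proof (rule almost_hat_op[OF k l, of _ "\<lambda>g h. g \<^bold>\<and> h"])
    fix i g h assume "i \<in> I" "g \<in> carrier G" "h \<in> carrier G" "k i = fst i #> g" "l i = fst i #> h"
    then show "(k \<^bold>\<and>\<^bsub>GPN G P\<^esub> l) i = fst i #> (g \<^bold>\<and> h)"
      using family.product_lmeet[of k l] car[OF k] car[OF l]
        convex_quotient.quot_lmeet[OF quotient_locale, of i g h]
      by (simp add: GPN_eq factor_eq)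
  qed (use car[OF k] car[OF l] in simp_all)
  moreover have "k \<^bold>\<or>\<^bsub>GPN G P\<^esub> l \<in> almost_hat" if k: "k \<in> almost_hat" and l: "l \<in> almost_hat" for k l
  proof (rule almost_hat_op[OF k l, of _ "\<lambda>g h. g \<^bold>\<or> h"])
    fix i g h assume "i \<in> I" "g \<in> carrier G" "h \<in> carrier G" "k i = fst i #> g" "l i = fst i #> h"
    then show "(k \<^bold>\<or>\<^bsub>GPN G P\<^esub> l) i = fst i #> (g \<^bold>\<or> h)"
      using family.product_ljoin[of k l] car[OF k] car[OF l]
        convex_quotient.quot_ljoin[OF quotient_locale, of i g h]
      by (simp add: GPN_eq factor_eq)
  qed (use car[OF k] car[OF l] in simp_all)
  ultimately show ?thesis by (simp add: l_subgroup_def)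
qed

lemma B_sum_eq: "B_sum G P = {k \<in> carrier (GPN G P). finite {i \<in> I. k i \<noteq> fst i}}"
  unfolding B_sum_def using carrier_sum_group[OF family.factor_group] by (simp add: GPN_eq)

lemma l_subgroup_generated_eq:
  "l_subgroup_generated (GPN G P) (hat G P ` carrier G \<union> B_sum G P) = almost_hat"
proof (rule subset_antisym)
  interpret T: abelian_lgroup "GPN G P" by (rule GPN_abelian)
  have "k \<in> almost_hat" if "k \<in> B_sum G P" for k
  proof -
    have "{i \<in> I. k i \<noteq> hat G P \<one> i} = {i \<in> I. k i \<noteq> fst i}" by (auto simp: hat_one)
    then show ?thesis
      using that unfolding B_sum_eq almost_hat_def by (auto intro!: bexI[of _ \<one>])
  qed
  then have "hat G P ` carrier G \<union> B_sum G P \<subseteq> almost_hat" using hat_almost_hat by blast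
  then show "l_subgroup_generated (GPN G P) (hat G P ` carrier G \<union> B_sum G P) \<subseteq> almost_hat"
    unfolding l_subgroup_generated_def using almost_hat_l_subgroup by blast
  show "almost_hat \<subseteq> l_subgroup_generated (GPN G P) (hat G P ` carrier G \<union> B_sum G P)"
    unfolding l_subgroup_generated_def
  proof (intro subsetI InterI, clarify)
    fix k H assume k: "k \<in> almost_hat" and "l_subgroup H (GPN G P)"
      and gen: "hat G P ` carrier G \<union> B_sum G P \<subseteq> H"
    then have H: "subgroup H (GPN G P)" by (simp add: l_subgroup_def)
    obtain g where g: "g \<in> carrier G" "finite {i \<in> I. k i \<noteq> hat G P g i}" using k by (rule almost_hatE)
    have kc: "k \<in> carrier (GPN G P)" using k by (simp add: almost_hat_def)
    \<comment> \<open>Dividing \<open>k\<close> by \<open>hat G P g\<close> leaves an element that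
      vanishes wherever the two agree. It has finite support and is the \<open>B\<close> part of
      \<open>k\<close>.\<close>
    let ?b = "inv\<^bsub>GPN G P\<^esub> hat G P g \<otimes>\<^bsub>GPN G P\<^esub> k"
    have bc: "?b \<in> carrier (GPN G P)" using kc hat_carrier[OF g(1)] by simp
    have "?b i = fst i" if "i \<in> I" "k i = hat G P g i" for i
      using that family.product_inv[of "hat G P g"] hat_carrier[OF g(1)]
        group.l_inv[OF family.factor_group[OF that(1)], of "k i"] kc
      by (auto simp: GPN_eq PiE_iff)
    then have "{i \<in> I. ?b i \<noteq> fst i} \<subseteq> {i \<in> I. k i \<noteq> hat G P g i}" by blast
    then have "?b \<in> B_sum G P" using g(2) bc unfolding B_sum_eq by (auto intro: finite_subset)
    then have "hat G P g \<otimes>\<^bsub>GPN G P\<^esub> ?b \<in> H"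
      using gen g(1) by (intro subgroup.m_closed[OF H, of "hat G P g" ?b]) auto
    then show "k \<in> H" using kc hat_carrier[OF g(1)] by (simp flip: T.m_assoc)
  qed
qed

lemma G_plus_B_eq: "G_plus_B G P = (GPN G P)\<lparr>carrier := almost_hat\<rparr>"
  by (simp add: G_plus_B_def l_subgroup_generated_eq)

lemma carrier_G_plus_B [simp]: "carrier (G_plus_B G P) = almost_hat"
  by (simp add: G_plus_B_eq)

lemma G_plus_B_abelian: "abelian_lgroup (G_plus_B G P)"
  unfolding G_plus_B_eq by (rule abelian_lgroup.sub_abelian_lgroup[OF GPN_abelian almost_hat_l_subgroup])

section \<open>Supports, polars and condition (M) in G + B\<close>

lemma labs_G_plus_B:
  assumes "k \<in> almost_hat"
  shows "labs (G_plus_B G P) k = (\<lambda>i\<in>I. labs (L i) (k i))"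
  using abelian_lgroup.sub_labs[OF GPN_abelian almost_hat_l_subgroup assms]
    family.product_labs[of k] almost_hat_PiE[OF assms]
  by (simp add: G_plus_B_eq GPN_eq)

lemma factor_total:
  "\<lbrakk>i \<in> I; X \<in> carrier (L i); Y \<in> carrier (L i)\<rbrakk> \<Longrightarrow> X \<preceq>\<^bsub>L i\<^esub> Y \<or> Y \<preceq>\<^bsub>L i\<^esub> X"
  unfolding factor_eq by (rule quot_total[OF index_Spec])

text \<open>Meets in the l-subgroup are those of the product, hence coordinatewise, and each factor
  is a chain. Disjointness is therefore disjointness of supports.\<close>

lemma disjoint_iff:
  assumes h: "h \<in> almost_hat" and s: "s \<in> almost_hat"
  shows "labs (G_plus_B G P) h \<^bold>\<and>\<^bsub>G_plus_B G P\<^esub> labs (G_plus_B G P) s = \<one>\<^bsub>G_plus_B G P\<^esub> \<longleftrightarrow>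
    (\<forall>i\<in>I. h i = fst i \<or> s i = fst i)"
proof -
  interpret K: abelian_lgroup "G_plus_B G P" by (rule G_plus_B_abelian)
  let ?h = "labs (G_plus_B G P) h" and ?s = "labs (G_plus_B G P) s"
  have hs: "?h \<in> almost_hat" "?s \<in> almost_hat" using K.labs_closed h s by simp_all
  have "?h \<^bold>\<and>\<^bsub>G_plus_B G P\<^esub> ?s = ?h \<^bold>\<and>\<^bsub>GPN G P\<^esub> ?s"
    using abelian_lgroup.sub_lmeet[OF GPN_abelian almost_hat_l_subgroup hs] by (simp add: G_plus_B_eq)
  also have "\<dots> = (\<lambda>i\<in>I. ?h i \<^bold>\<and>\<^bsub>L i\<^esub> ?s i)"
    using family.product_lmeet almost_hat_PiE[OF hs(1)] almost_hat_PiE[OF hs(2)] by (simp add: GPN_eq)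
  also have "\<dots> = (\<lambda>i\<in>I. labs (L i) (h i) \<^bold>\<and>\<^bsub>L i\<^esub> labs (L i) (s i))"
    by (simp add: labs_G_plus_B h s cong: restrict_cong)
  finally have "?h \<^bold>\<and>\<^bsub>G_plus_B G P\<^esub> ?s = \<dots>" .
  moreover have "\<one>\<^bsub>G_plus_B G P\<^esub> = (\<lambda>i\<in>I. fst i)" by (simp add: G_plus_B_eq GPN_eq cong: restrict_cong)
  ultimately have "?h \<^bold>\<and>\<^bsub>G_plus_B G P\<^esub> ?s = \<one>\<^bsub>G_plus_B G P\<^esub> \<longleftrightarrow>
      (\<forall>i\<in>I. labs (L i) (h i) \<^bold>\<and>\<^bsub>L i\<^esub> labs (L i) (s i) = fst i)"
    by (auto simp: fun_eq_iff restrict_def)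
  also have "\<dots> \<longleftrightarrow> (\<forall>i\<in>I. h i = fst i \<or> s i = fst i)"
  proof (rule ball_cong[OF HOL.refl])
    fix i assume i: "i \<in> I"
    have c: "h i \<in> carrier (L i)" "s i \<in> carrier (L i)"
      using almost_hat_PiE[OF h] almost_hat_PiE[OF s] i by auto
    show "labs (L i) (h i) \<^bold>\<and>\<^bsub>L i\<^esub> labs (L i) (s i) = fst i \<longleftrightarrow> h i = fst i \<or> s i = fst i"
      using abelian_lgroup.lmeet_eq_one_total[OF family.factor[OF i] c
          factor_total[OF i abelian_lgroup.labs_closed[OF family.factor[OF i] c(1)]
            abelian_lgroup.labs_closed[OF family.factor[OF i] c(2)]]]
      by simp
  qed
  finally show ?thesis .
qed

text \<open>These elements of \<open>B\<close> isolate one factor. They test bipolars index by index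
  and transfer (M) to a single quotient.\<close>

definition spike :: "'a set \<times> nat \<Rightarrow> 'a set \<Rightarrow> 'a set \<times> nat \<Rightarrow> 'a set" where
  "spike i X = (\<lambda>j\<in>I. if j = i then X else fst j)"

lemma spike_apply: "j \<in> I \<Longrightarrow> spike i X j = (if j = i then X else fst j)"
  by (simp add: spike_def)

lemma spike_almost_hat:
  assumes "i \<in> I" "X \<in> carrier (L i)"
  shows "spike i X \<in> almost_hat"
proof -
  have "fst j \<in> carrier (L j)" if "j \<in> I" for j
    using monoid.one_closed[OF group.is_monoid[OF family.factor_group[OF that]]] by simp
  then have "spike i X \<in> carrier (GPN G P)" using assms by (simp add: GPN_eq spike_def PiE_iff)
  moreover have "{j \<in> I. spike i X j \<noteq> hat G P \<one> j} \<subseteq> {i}" by (auto simp: spike_apply hat_one)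
  then have "finite {j \<in> I. spike i X j \<noteq> hat G P \<one> j}" by (rule finite_subset) simp
  ultimately show ?thesis unfolding almost_hat_def using one_closed by blast
qed

lemma polar_eq:
  assumes "S \<subseteq> almost_hat"
  shows "polar (G_plus_B G P) S = {h \<in> almost_hat. \<forall>s\<in>S. \<forall>i\<in>I. h i = fst i \<or> s i = fst i}"
  unfolding polar_def carrier_G_plus_B
  by (intro Collect_cong conj_cong ball_cong HOL.refl disjoint_iff) (use assms in blast)+

text \<open>If \<open>k\<close> vanishes at \<open>i\<close> but \<open>h\<close> does not, the
  spike of \<open>h\<close> at \<open>i\<close> is disjoint from \<open>k\<close> and not from
  \<open>h\<close>. Conversely, if \<open>h\<close> vanishes wherever \<open>k\<close> does,
  whatever is disjoint from \<open>k\<close> is disjoint from \<open>h\<close>.\<close>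

lemma bipolar_eq:
  assumes k: "k \<in> almost_hat"
  shows "polar (G_plus_B G P) (polar (G_plus_B G P) {k}) =
    {h \<in> almost_hat. \<forall>i\<in>I. k i = fst i \<longrightarrow> h i = fst i}"
proof -
  have polar_k: "polar (G_plus_B G P) {k} = {s \<in> almost_hat. \<forall>i\<in>I. s i = fst i \<or> k i = fst i}"
    using k by (simp add: polar_eq)
  have "(\<forall>s\<in>polar (G_plus_B G P) {k}. \<forall>i\<in>I. h i = fst i \<or> s i = fst i) \<longleftrightarrow>
      (\<forall>i\<in>I. k i = fst i \<longrightarrow> h i = fst i)" if h: "h \<in> almost_hat" for h
  proof (intro iffI ballI impI)
    fix i assume all: "\<forall>s\<in>polar (G_plus_B G P) {k}. \<forall>i\<in>I. h i = fst i \<or> s i = fst i"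
      and i: "i \<in> I" "k i = fst i"
    have "h i \<in> carrier (L i)" using almost_hat_PiE[OF h] i by auto
    then have "spike i (h i) \<in> polar (G_plus_B G P) {k}"
      using i spike_almost_hat by (auto simp: polar_k spike_apply)
    then have "h i = fst i \<or> spike i (h i) i = fst i" using all i(1) by blast
    then show "h i = fst i" using i(1) by (simp add: spike_apply)
  qed (auto simp: polar_k)
  moreover have "polar (G_plus_B G P) {k} \<subseteq> almost_hat" by (auto simp: polar_k)
  ultimately show ?thesis by (simp add: polar_eq cong: conj_cong)
qed

lemma mem_principal_convex_iff:
  assumes h: "h \<in> almost_hat" and k: "k \<in> almost_hat"
  shows "h \<in> principal_convex (G_plus_B G P) k \<longleftrightarrow>
    (\<exists>n::nat. \<forall>i\<in>I. labs (L i) (h i) \<preceq>\<^bsub>L i\<^esub> labs (L i) (k i) [^]\<^bsub>L i\<^esub> n)"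
proof -
  have "x [^]\<^bsub>G_plus_B G P\<^esub> (n::nat) = (\<lambda>i\<in>I. x i [^]\<^bsub>L i\<^esub> n)" for x n
  proof -
    have "x [^]\<^bsub>G_plus_B G P\<^esub> n = x [^]\<^bsub>product_lgroup I L\<^esub> n"
      by (rule nat_pow_cong) (simp_all add: G_plus_B_eq GPN_eq)
    then show ?thesis by (simp add: family.product_pow)
  qed
  moreover have "x \<preceq>\<^bsub>G_plus_B G P\<^esub> y \<longleftrightarrow> (\<forall>i\<in>I. x i \<preceq>\<^bsub>L i\<^esub> y i)" for x y
    by (simp add: G_plus_B_eq GPN_eq)
  ultimately show ?thesis
    using h by (simp add: principal_convex_def labs_G_plus_B h k)
qed

text \<open>Bipolars are given by supports and principal subgroups by coordinatewise bounds. The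
  exponent is chosen before the index, so (M) is a uniform bound over all factors.\<close>

lemma class_M_G_plus_B_iff:
  "class_M (G_plus_B G P) \<longleftrightarrow>
    (\<forall>k\<in>almost_hat. \<forall>h\<in>almost_hat. (\<forall>i\<in>I. k i = fst i \<longrightarrow> h i = fst i) \<longrightarrow>
      (\<exists>n::nat. \<forall>i\<in>I. labs (L i) (h i) \<preceq>\<^bsub>L i\<^esub> labs (L i) (k i) [^]\<^bsub>L i\<^esub> n))"
  unfolding abelian_lgroup.class_M_iff[OF G_plus_B_abelian] carrier_G_plus_B
proof (rule ball_cong[OF HOL.refl])
  fix k assume k: "k \<in> almost_hat"
  show "polar (G_plus_B G P) (polar (G_plus_B G P) {k}) \<subseteq> principal_convex (G_plus_B G P) k \<longleftrightarrow>
    (\<forall>h\<in>almost_hat. (\<forall>i\<in>I. k i = fst i \<longrightarrow> h i = fst i) \<longrightarrow>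
      (\<exists>n::nat. \<forall>i\<in>I. labs (L i) (h i) \<preceq>\<^bsub>L i\<^esub> labs (L i) (k i) [^]\<^bsub>L i\<^esub> n))"
    unfolding bipolar_eq[OF k] subset_iff
    by (simp add: mem_principal_convex_iff[OF _ k] Ball_def imp_conjL cong: imp_cong)
qed

text \<open>An inequality in a factor is lifted to \<open>G\<close> up to some \<open>w\<close> from
  the prime. This is the form that \<open>Max_bound\<close> delivers.\<close>

lemma factor_le_iff:
  assumes "i \<in> I" "x \<in> carrier G" "y \<in> carrier G"
  shows "labs (L i) (fst i #> x) \<preceq>\<^bsub>L i\<^esub> labs (L i) (fst i #> y) [^]\<^bsub>L i\<^esub> n \<longleftrightarrow>
    (\<exists>w\<in>fst i. labs G x \<preceq> w \<otimes> labs G y [^] (n::nat))"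
proof -
  interpret convex_quotient G "fst i" using assms(1) by (rule quotient_locale)
  have "labs (L i) (fst i #> y) [^]\<^bsub>L i\<^esub> n = fst i #> (labs G y [^] n)"
    using assms by (simp add: factor_eq quot_labs quot_pow)
  moreover have "labs (L i) (fst i #> x) = fst i #> labs G x"
    using assms by (simp add: factor_eq quot_labs)
  ultimately show ?thesis
    using quot_le_iff[of "labs G x" "labs G y [^] n"] assms by (simp add: factor_eq del: quot_lgroup_simps)
qed

section \<open>From (M) to maximality and density\<close>

lemma class_M_imp_Max:
  assumes M: "class_M (G_plus_B G P)" and p: "p \<in> P"
  shows "p \<in> Max_lgroup G"
proof -
  have pS: "p \<in> Spec_lgroup G" using p P_Spec by blast
  have i: "(p, 0) \<in> I" using p by (simp add: GPN_index_def)
  interpret p: convex_quotient G p using quotient_locale[OF i] by simp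
  have "H = p" if H: "convex_l_subgroup H G" "H \<noteq> carrier G" "p \<subseteq> H" for H
  proof (rule ccontr)
    assume "H \<noteq> p"
    then obtain g where g: "g \<in> H" "g \<notin> p" using H by blast
    obtain f where f: "f \<in> carrier G" "f \<notin> H" using H convex_mem_carrier[OF H(1)] by blast
    have gc: "g \<in> carrier G" using H(1) g(1) by (rule convex_mem_carrier)
    \<comment> \<open>Both elements live in one copy of the quotient by \<open>p\<close>. As
      \<open>g\<close> is outside \<open>p\<close>, the support of \<open>k\<close> is exactly that
      index and contains the support of \<open>h\<close>.\<close>
    define k where "k = spike (p, 0) (p #> g)"
    define h where "h = spike (p, 0) (p #> f)"
    have "p #> g \<in> carrier (L (p, 0))" "p #> f \<in> carrier (L (p, 0))"
      using p.coset_carrier gc f(1) by (simp_all add: factor_eq del: quot_lgroup_simps)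
    then have kh: "k \<in> almost_hat" "h \<in> almost_hat"
      unfolding k_def h_def using spike_almost_hat[OF i] by blast+
    have "p #> g \<noteq> p" using g gc p.coset_eq_self_iff by blast
    then have "\<forall>j\<in>I. k j = fst j \<longrightarrow> h j = fst j" by (auto simp: k_def h_def spike_apply)
    then obtain n where "\<forall>j\<in>I. labs (L j) (h j) \<preceq>\<^bsub>L j\<^esub> labs (L j) (k j) [^]\<^bsub>L j\<^esub> (n::nat)"
      using M kh unfolding class_M_G_plus_B_iff by blast
    then have "labs (L (p, 0)) (h (p, 0)) \<preceq>\<^bsub>L (p, 0)\<^esub> labs (L (p, 0)) (k (p, 0)) [^]\<^bsub>L (p, 0)\<^esub> n"
      using i by blast
    then obtain w where w: "w \<in> p" "labs G f \<preceq> w \<otimes> labs G g [^] n"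
      using factor_le_iff[OF i f(1) gc, of n] i by (auto simp: k_def h_def spike_apply)
    have "labs G g \<in> H" using g(1) gc H(1) by (simp add: convex_labs_iff)
    \<comment> \<open>Both \<open>w\<close>, through \<open>p \<subseteq> H\<close>, and the
      absolute value of \<open>g\<close> lie in \<open>H\<close>, so the bound forces
      \<open>f\<close> into \<open>H\<close>.\<close>
    then have "w \<otimes> labs G g [^] n \<in> H"
      using w(1) H by (intro convex_mult_closed[OF H(1)] convex_pow_closed[OF H(1)]) auto
    then have "labs G f \<in> H" using convex_le[OF H(1) _ _ w(2)] f(1) by simp
    then show False using f H(1) by (simp add: convex_labs_iff)
  qed
  then show ?thesis using pS by (auto simp: Max_lgroup_def Spec_lgroup_def)
qed

lemma class_M_imp_dense:
  assumes M: "class_M (G_plus_B G P)"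
  shows "dense_subset (patch_topology G) P"
  unfolding dense_patch_iff[OF P_Spec]
proof (intro ballI impI)
  fix b a assume b: "b \<in> carrier G" and a: "a \<in> carrier G" and sub: "\<forall>p\<in>P. b \<in> p \<longrightarrow> a \<in> p"
  have "\<forall>i\<in>I. hat G P b i = fst i \<longrightarrow> hat G P a i = fst i"
    using sub a b index_prime convex_quotient.coset_eq_self_iff[OF quotient_locale]
    by (simp add: hat_apply)
  then obtain n where n: "\<forall>i\<in>I. labs (L i) (hat G P a i) \<preceq>\<^bsub>L i\<^esub> labs (L i) (hat G P b i) [^]\<^bsub>L i\<^esub> (n::nat)"
    using M hat_almost_hat[OF a] hat_almost_hat[OF b] unfolding class_M_G_plus_B_iff by blast
  let ?x = "labs G a" and ?y = "labs G b [^] n"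
  \<comment> \<open>This element is the positive part of \<open>?x \<otimes> inv ?y\<close>. It lies
    in every \<open>p\<close> because \<open>?x\<close> is below \<open>?y\<close> modulo
    \<open>p\<close>. Since the members of \<open>P\<close> intersect trivially, these inequalities
    combine into one in \<open>G\<close>.\<close>
  have "(?x \<^bold>\<or> ?y) \<otimes> inv ?y \<in> p" if p: "p \<in> P" for p
  proof -
    have i: "(p, 0) \<in> I" using p by (simp add: GPN_index_def)
    interpret p: convex_quotient G p using quotient_locale[OF i] by simp
    have "\<exists>w\<in>p. ?x \<preceq> w \<otimes> ?y" using n i factor_le_iff[OF i a b, of n] by (auto simp: hat_apply)
    then have le: "p #> ?x \<preceq>\<^bsub>quot_lgroup G p\<^esub> p #> ?y" using p.quot_le_iff[of ?x ?y] a b by simp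
    have "p #> (?x \<^bold>\<or> ?y) = p #> ?y"
    proof (rule p.quot_le_antisym)
      show "p #> (?x \<^bold>\<or> ?y) \<preceq>\<^bsub>quot_lgroup G p\<^esub> p #> ?y"
        using a b by (intro p.quot_le_join[OF _ _ _ le] p.quot_le) simp_all
      show "p #> ?y \<preceq>\<^bsub>quot_lgroup G p\<^esub> p #> (?x \<^bold>\<or> ?y)"
        using a b by (intro p.quot_le) simp_all
    qed (use a b in simp_all)
    then show ?thesis using a b by (simp add: p.coset_eq_iff)
  qed
  moreover have "(?x \<^bold>\<or> ?y) \<otimes> inv ?y \<in> carrier G" using a b by simp
  ultimately have "(?x \<^bold>\<or> ?y) \<otimes> inv ?y \<in> carrier G \<inter> \<Inter>P" by blast
  then have "(?x \<^bold>\<or> ?y) \<otimes> inv ?y = \<one>" unfolding P_Inter by blast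
  then have "?x \<^bold>\<or> ?y = ?y" using a b inv_equality[of "?x \<^bold>\<or> ?y" "inv ?y"] by simp
  then have "?x \<preceq> ?y" using a b ljoin_upper1[of ?x ?y] by simp
  then show "a \<in> principal_convex G b" using a by (auto simp: principal_convex_def)
qed

section \<open>From maximality and density to (M)\<close>

lemma Max_dense_imp_class_M:
  assumes PM: "P \<subseteq> Max_lgroup G" and dense: "dense_subset (patch_topology G) P"
  shows "class_M (G_plus_B G P)"
  unfolding class_M_G_plus_B_iff
proof (intro ballI impI)
  fix k h assume k: "k \<in> almost_hat" and h: "h \<in> almost_hat"
    and supp: "\<forall>i\<in>I. k i = fst i \<longrightarrow> h i = fst i"
  obtain g where g: "g \<in> carrier G" "finite {i \<in> I. k i \<noteq> hat G P g i}" using k by (rule almost_hatE)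
  obtain f where f: "f \<in> carrier G" "finite {i \<in> I. h i \<noteq> hat G P f i}" using h by (rule almost_hatE)
  define A where "A = {i \<in> I. k i \<noteq> hat G P g i} \<union> {i \<in> I. h i \<noteq> hat G P f i}"
  have A: "finite A" using g f by (simp add: A_def)
  have "f \<in> p" if p: "p \<in> P" and gp: "g \<in> p" for p
  proof -
    \<comment> \<open>Infinitely many indices carry the prime \<open>p\<close> while
      \<open>A\<close> is finite, so at some index \<open>k\<close> and \<open>h\<close> show the
      cosets of \<open>g\<close> and \<open>f\<close> unaltered.\<close>
    have "infinite (range (Pair p :: nat \<Rightarrow> _))" by (rule range_inj_infinite) (simp add: inj_def)
    then obtain n :: nat where n: "(p, n) \<notin> A" using A by (meson finite_subset image_subsetI)
    have i: "(p, n) \<in> I" using p by (simp add: GPN_index_def)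
    interpret p: convex_quotient G p using quotient_locale[OF i] by simp
    have "k (p, n) = p #> g" "h (p, n) = p #> f" using n i by (auto simp: A_def hat_apply)
    then show ?thesis using supp i gp g(1) f(1) p.coset_eq_self_iff by fastforce
  qed
  then have "f \<in> principal_convex G g" using dense g(1) f(1) unfolding dense_patch_iff[OF P_Spec] by blast
  then obtain m where m: "labs G f \<preceq> labs G g [^] (m::nat)" by (auto simp: principal_convex_def)
  let ?le = "\<lambda>i n. labs (L i) (h i) \<preceq>\<^bsub>L i\<^esub> labs (L i) (k i) [^]\<^bsub>L i\<^esub> (n::nat)"
  have outside: "?le i m" if "i \<in> I" "i \<notin> A" for i
  proof -
    have "\<one> \<in> fst i" using convex_one_closed[OF Spec_convex[OF index_Spec[OF that(1)]]] .
    then show ?thesis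
      using that m f(1) g(1) factor_le_iff[OF that(1) f(1) g(1), of m]
      by (auto simp: A_def hat_apply intro!: bexI[of _ \<one>])
  qed
  have "\<exists>n. ?le i n" if i: "i \<in> I" for i
  proof -
    interpret p: convex_quotient G "fst i" using i by (rule quotient_locale)
    obtain u where u: "u \<in> carrier G" "k i = fst i #> u"
      using factor_carrierE[OF i] almost_hat_PiE[OF k] i by blast
    obtain v where v: "v \<in> carrier G" "h i = fst i #> v"
      using factor_carrierE[OF i] almost_hat_PiE[OF h] i by blast
    show ?thesis
    proof (cases "u \<in> fst i")
      case True
      then have "k i = fst i" using u by (simp add: p.coset_eq_self_iff)
      then have "fst i #> v = fst i" using supp i v(2) by simp
      then have "v \<in> fst i" using p.coset_eq_self_iff[OF v(1)] by blast
      then have "labs G v \<in> fst i" using v(1) by (simp add: convex_labs_iff p.convex)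
      \<comment> \<open>Where \<open>k\<close> vanishes, so does \<open>h\<close>; exponent zero
        suffices, with the absolute value of \<open>v\<close> itself as \<open>w\<close>.\<close>
      then have "\<exists>w\<in>fst i. labs G v \<preceq> w \<otimes> labs G u [^] (0::nat)"
        using u v by (intro bexI[of _ "labs G v"]) simp_all
      then show ?thesis using u v factor_le_iff[OF i v(1) u(1)] by metis
    next
      case False
      have "fst i \<in> Max_lgroup G" using PM index_prime[OF i] by blast
      then obtain w n where "w \<in> fst i" "labs G v \<preceq> w \<otimes> labs G u [^] (n::nat)"
        using Max_bound[OF _ u(1) False v(1)] by blast
      then show ?thesis using u v factor_le_iff[OF i v(1) u(1)] by metis
    qed
  qed
  then obtain N where N: "\<And>i. i \<in> I \<Longrightarrow> ?le i (N i)" by metis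
  \<comment> \<open>The exponent \<open>m\<close> serves every index outside \<open>A\<close>, and
    \<open>N\<close> handles the finitely many others. Since powers of an absolute value increase
    with the exponent, the maximum serves all.\<close>
  define n where "n = Max (insert m (N ` A))"
  have "?le i n" if i: "i \<in> I" for i
  proof -
    interpret Li: abelian_lgroup "L i" using i by (rule family.factor)
    have c: "k i \<in> carrier (L i)" "h i \<in> carrier (L i)"
      using almost_hat_PiE[OF k] almost_hat_PiE[OF h] i by auto
    obtain n' where n': "n' \<le> n" "?le i n'"
    proof (cases "i \<in> A")
      case True
      then show thesis using that[of "N i"] N[OF i] A by (simp add: n_def)
    next
      case False
      then show thesis using that[of m] outside[OF i] A by (simp add: n_def)
    qed
    show ?thesis
      by (rule Li.lle_trans[OF n'(2) Li.pow_mono_exp[OF n'(1) Li.labs_ge_one[OF c(1)]]]) (use c in simp_all)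
  qed
  then show "\<exists>n. \<forall>i\<in>I. ?le i n" by blast
qed

end

theorem theorem7p1:
  fixes G :: "('a, 'b) lgroup_scheme" and P :: "'a set set"
  assumes "abelian_lgroup G"
    and "P \<subseteq> Spec_lgroup G"
    and "carrier G \<inter> \<Inter>P = {\<one>\<^bsub>G\<^esub>}"
  shows "(class_M (G_plus_B G P) \<longleftrightarrow>
            P \<subseteq> Max_lgroup G \<and> dense_subset (patch_topology G) P)
       \<and> (P \<subseteq> Max_lgroup G \<and> dense_subset (patch_topology G) P \<longleftrightarrow>
            class_Y G \<and> P \<subseteq> Max_lgroup G \<and>
            dense_subset (subtopology (patch_topology G) (Max_lgroup G)) P)"
proof -
  interpret abelian_lgroup G by fact
  interpret G_plus_B_construction G P by unfold_locales fact+
  show ?thesis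
    using class_M_imp_Max class_M_imp_dense Max_dense_imp_class_M dense_patch_iff_class_Y[OF P_Spec]
    by blast
qed

end
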